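(* Suppose that each $Z^\pm_\lambda$ is affine with respect to $(x,y)$ and $C^\infty$-smooth with respect to the real parameter $\lambda\sim0$, that $$Z_0^\pm(x,y)=\left(b^\pm+a_{1,1}^\pm x+a_{1,2}^\pm y,\ a_{2,1}^\pm x+a_{2,2}^\pm y\right)$$ ($Z_0=Z_0^+$ for $y>0$ and $Z_0=Z_0^-$ for $y<0$) with $b^+>0$, $a_{2,1}^+>0$, $a_{2,1}^-<0$, that the origin is a two-fold of $Z_0$ of type $VV_1$ (so $b^->0$) or $VI_3$ (so $b^-<0$ and $a_{2,1}^+b^--a_{2,1}^-b^+>0$), that, writing $Z^\pm_\lambda=(X^\pm_\lambda,Y^\pm_\lambda)$, $$\frac{\partial Y^-_0}{\partial\lambda}\frac{\partial Y^+_0}{\partial x}\neq\frac{\partial Y^+_0}{\partial\lambda}\frac{\partial Y^-_0}{\partial x}\quad\text{at }(x,y,\lambda)=(0,0,0),$$ and that $\phi$ is a regularization function. Let $D_\pm$ and $T_\pm$ be the determinant and trace of the matrix $(a_{i,j}^\pm)$, and let $C=a_{2,1}^+a_{1,1}^--a_{2,1}^-a_{1,1}^+$. Then the following statements hold. (1) Assume $D_+>0$ and $4D_+-T_+^2>0$. In both the $VV_1$ and $VI_3$ cases, the slow divergence integral $I^a$ has exactly one zero counting multiplicity in the interior of its maximal domain $\mathcal{J}^a$ if and only if $CT_+<0$. (2) Assume $D_->0$ and $4D_--T_-^2>0$. In the $VV_1$ case, the slow divergence integral $I^b$ has exactly one zero counting multiplicity in the interior of its maximal domain $\mathcal{J}^b$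 if and only if $CT_-<0$.
   Context: **Constants.** $\Delta=a_{2,1}^+b^--a_{2,1}^-b^+>0$. **Regularization function.** A $C^\infty$ function $\phi:\mathbb{R}\to(0,1)$ such that: $\phi(s)\to1$ as $s\to\infty$ and $\phi(s)\to0$ as $s\to-\infty$; $\phi'(s)>0$ for all $s$; and the functions $\phi_+(s)=\phi(s^{-1})$ for $s>0$, $\phi_+(0)=1$, and $\phi_-(s)=\phi(-s^{-1})$ for $s>0$, $\phi_-(0)=0$, are $C^\infty$ at $s=0$. **Sliding vector field.** $X^{sl}_0(x)=\dfrac{\Delta+Cx}{a_{2,1}^+-a_{2,1}^-}$, where $a_{2,1}^+-a_{2,1}^->0$. **Poincaré half-maps.** $\Pi^a_0$ (resp. $\Pi^b_0$) maps $x\ge0$ to $x'\le0$ if the forward orbit of $Z^+_0$ (resp. $Z^-_0$) starting at $(x,0)$ reaches $\{y=0\}$ at $(x',0)$ after a finite time $\tau>0$, staying in $\{y>0\}$ (resp. $\{y<0\}$) for times in $(0,\tau)$. The domains of these maps are half-open intervals contained in $[0,+\infty)$. **Slow divergence integral.** For $c\in\{a,b\}$, $$I^c(x)=(a_{2,1}^+-a_{2,1}^-)\,\phi'\!\left(\phi^{-1}\!\left(\frac{-a_{2,1}^-}{a_{2,1}^+-a_{2,1}^-}\right)\right)\int_{\Pi^c_0(x)}^x\frac{u\,du}{X^{sl}_0(u)}.$$ **Maximal domain.** $\mathcal{J}^c$ is the maximal half-open interval contained in the domain of $\Pi^c_0$ such that $X^{sl}_0$ does not vanish on $[\Pi^c_0(x),x]$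 for every $x\in\mathcal{J}^c$ (it may be empty). Explicitly: if $C=0$ it is the whole domain of $\Pi^c_0$; if $C\ne0$ put $x^*=-\Delta/C$; for $x^*>0$ it consists of the $x$ in the domain with $x<x^*$, and for $x^*<0$ of the $x$ in the domain with $\Pi^c_0(x)>x^*$. *)

theory Defs
  imports "HOL-Analysis.Analysis"
begin

(* C-infinity smoothness on a set of reals without isolated points, witnessed by the sequence of
   all derivatives.  Derivatives are taken within S, hence one-sided at boundary points in S. *)
definition smooth_on_set :: "(real \<Rightarrow> 'b::real_normed_vector) \<Rightarrow> real set \<Rightarrow> bool" where
  "smooth_on_set f S \<longleftrightarrow>
     (\<exists>g. (\<forall>x\<in>S. g (0::nat) x = f x) \<and>
          (\<forall>n. \<forall>x\<in>S. (g n has_vector_derivative g (Suc n) x) (at x within S)))"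

definition regularization_function :: "(real \<Rightarrow> real) \<Rightarrow> bool" where
  "regularization_function \<phi> \<longleftrightarrow>
     smooth_on_set \<phi> UNIV \<and>
     (\<forall>s. 0 < \<phi> s \<and> \<phi> s < 1) \<and>
     (\<phi> \<longlongrightarrow> 1) at_top \<and>
     (\<phi> \<longlongrightarrow> 0) at_bot \<and>
     (\<forall>s. deriv \<phi> s > 0) \<and>
     smooth_on_set (\<lambda>s. if s = 0 then 1 else \<phi> (inverse s)) {0..} \<and>
     smooth_on_set (\<lambda>s. if s = 0 then 0 else \<phi> (- inverse s)) {0..}"

(* Planar vector fields have type real * real => real * real; a family Z takes the parameter
   first.  Only parameters close to 0 matter. *)
definition affine_map :: "(real \<times> real \<Rightarrow> real \<times> real) \<Rightarrow> bool" where
  "affine_map F \<longleftrightarrow> (\<exists>c L. linear L \<and> (\<forall>p. F p = c + L p))"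

(* For affine fields, smoothness in the parameter at each fixed point amounts to smoothness of
   the coefficients, hence to joint smoothness. *)
definition smooth_affine_family :: "(real \<Rightarrow> real \<times> real \<Rightarrow> real \<times> real) \<Rightarrow> bool" where
  "smooth_affine_family Z \<longleftrightarrow>
     (\<exists>\<epsilon>>0. (\<forall>\<mu>\<in>{-\<epsilon><..<\<epsilon>}. affine_map (Z \<mu>)) \<and>
             (\<forall>p. smooth_on_set (\<lambda>\<mu>. Z \<mu> p) {-\<epsilon><..<\<epsilon>}))"

definition X_origin :: "(real \<times> real \<Rightarrow> real \<times> real) \<Rightarrow> real" where
  "X_origin F = fst (F (0, 0))"

definition Yx_origin :: "(real \<times> real \<Rightarrow> real \<times> real) \<Rightarrow> real" where
  "Yx_origin F = deriv (\<lambda>x. snd (F (x, 0))) 0"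

definition Ylam_origin :: "(real \<Rightarrow> real \<times> real \<Rightarrow> real \<times> real) \<Rightarrow> real" where
  "Ylam_origin Z = deriv (\<lambda>\<mu>. snd (Z \<mu> (0, 0))) 0"

(* Quadratic tangency with {y = 0}: where Y = 0, the second Lie derivative of y along (X, Y) is
   X * dY/dx. *)
definition fold_at_origin :: "(real \<times> real \<Rightarrow> real \<times> real) \<Rightarrow> bool" where
  "fold_at_origin F \<longleftrightarrow> snd (F (0, 0)) = 0 \<and> X_origin F \<noteq> 0 \<and> Yx_origin F \<noteq> 0"

definition two_fold ::
  "(real \<times> real \<Rightarrow> real \<times> real) \<Rightarrow> (real \<times> real \<Rightarrow> real \<times> real) \<Rightarrow> bool" where
  "two_fold Fp Fm \<longleftrightarrow> fold_at_origin Fp \<and> fold_at_origin Fm"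

(* Fp acts in y > 0 and Fm in y < 0.  The fold of Fp is visible iff X * dY/dx > 0, that of Fm iff
   X * dY/dx < 0.  Opposite signs of dY/dx mean that there is sliding on both sides of the
   origin in {y = 0}. *)
definition VV1 ::
  "(real \<times> real \<Rightarrow> real \<times> real) \<Rightarrow> (real \<times> real \<Rightarrow> real \<times> real) \<Rightarrow> bool" where
  "VV1 Fp Fm \<longleftrightarrow> two_fold Fp Fm \<and>
     X_origin Fp * Yx_origin Fp > 0 \<and> X_origin Fm * Yx_origin Fm < 0 \<and>
     Yx_origin Fp * Yx_origin Fm < 0"

(* The last condition determines the direction of the sliding flow at the origin. *)
definition VI3 ::
  "(real \<times> real \<Rightarrow> real \<times> real) \<Rightarrow> (real \<times> real \<Rightarrow> real \<times> real) \<Rightarrow> bool" where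
  "VI3 Fp Fm \<longleftrightarrow> two_fold Fp Fm \<and>
     X_origin Fp * Yx_origin Fp > 0 \<and> X_origin Fm * Yx_origin Fm > 0 \<and>
     Yx_origin Fp * Yx_origin Fm < 0 \<and>
     Yx_origin Fp * X_origin Fm - Yx_origin Fm * X_origin Fp > 0"

definition Delta :: "real \<Rightarrow> real^2^2 \<Rightarrow> real \<Rightarrow> real^2^2 \<Rightarrow> real" where
  "Delta bp Ap bm Am = Ap$2$1 * bm - Am$2$1 * bp"

definition C_const :: "real^2^2 \<Rightarrow> real^2^2 \<Rightarrow> real" where
  "C_const Ap Am = Ap$2$1 * Am$1$1 - Am$2$1 * Ap$1$1"

definition sliding_field ::
  "real \<Rightarrow> real^2^2 \<Rightarrow> real \<Rightarrow> real^2^2 \<Rightarrow> real \<Rightarrow> real" where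
  "sliding_field bp Ap bm Am x =
     (Delta bp Ap bm Am + C_const Ap Am * x) / (Ap$2$1 - Am$2$1)"

(* The forward orbit of F from (x,0) stays in H during (0,tau) and is at (x',0) at time tau. *)
definition half_return ::
  "(real \<times> real \<Rightarrow> real \<times> real) \<Rightarrow> (real \<times> real) set \<Rightarrow> real \<Rightarrow> real \<Rightarrow> bool" where
  "half_return F H x x' \<longleftrightarrow> x \<ge> 0 \<and> x' \<le> 0 \<and>
     (\<exists>\<tau>>0. \<exists>\<gamma>::real \<Rightarrow> real \<times> real.
        \<gamma> 0 = (x, 0) \<and> \<gamma> \<tau> = (x', 0) \<and>
        (\<forall>t\<in>{0..\<tau>}. (\<gamma> has_vector_derivative F (\<gamma> t)) (at t within {0..\<tau>})) \<and>
        (\<forall>t\<in>{0<..<\<tau>}. \<gamma> t \<in> H))"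

definition half_map_domain ::
  "(real \<times> real \<Rightarrow> real \<times> real) \<Rightarrow> (real \<times> real) set \<Rightarrow> real set" where
  "half_map_domain F H = {x. \<exists>x'. half_return F H x x'}"

(* Meaningful on half_map_domain F H; x' is then unique because F is affine and H avoids
   {y = 0}. *)
definition half_map ::
  "(real \<times> real \<Rightarrow> real \<times> real) \<Rightarrow> (real \<times> real) set \<Rightarrow> real \<Rightarrow> real" where
  "half_map F H x = (THE x'. half_return F H x x')"

abbreviation upper :: "(real \<times> real) set" where
  "upper \<equiv> {p. snd p > 0}"

abbreviation lower :: "(real \<times> real) set" where
  "lower \<equiv> {p. snd p < 0}"

(* P is a half-map and Xsl the sliding vector field. *)
definition slow_divergence_integral ::
  "(real \<Rightarrow> real) \<Rightarrow> real^2^2 \<Rightarrow> real^2^2 \<Rightarrow> (real \<Rightarrow> real) \<Rightarrow> (real \<Rightarrow> real) \<Rightarrow> real \<Rightarrow> real" where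
  "slow_divergence_integral \<phi> Ap Am Xsl P x =
     (Ap$2$1 - Am$2$1) * deriv \<phi> (inv \<phi> (- Am$2$1 / (Ap$2$1 - Am$2$1))) *
     integral {P x..x} (\<lambda>u. u / Xsl u)"

(* As the half-maps are decreasing with a half-open interval as domain, this set is itself the
   maximal interval with the stated property; its explicit form is proved below. *)
definition maximal_domain ::
  "(real \<Rightarrow> real) \<Rightarrow> (real \<times> real \<Rightarrow> real \<times> real) \<Rightarrow> (real \<times> real) set \<Rightarrow> real set" where
  "maximal_domain Xsl F H =
     {x \<in> half_map_domain F H. \<forall>u\<in>{half_map F H x..x}. Xsl u \<noteq> 0}"

(* Order of the first non-vanishing derivative; used where f is smooth near x. *)
definition zero_multiplicity :: "(real \<Rightarrow> real) \<Rightarrow> real \<Rightarrow> enat" where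
  "zero_multiplicity f x =
     (if \<exists>n. (deriv ^^ n) f x \<noteq> 0 then enat (LEAST n. (deriv ^^ n) f x \<noteq> 0) else \<infinity>)"

definition zeros_counting_multiplicity :: "(real \<Rightarrow> real) \<Rightarrow> real set \<Rightarrow> enat" where
  "zeros_counting_multiplicity f S =
     (if finite {x \<in> S. f x = 0} then (\<Sum>x\<in>{x \<in> S. f x = 0}. zero_multiplicity f x) else \<infinity>)"


lemma origin_data_affine:
  assumes "\<forall>x y. F (x, y) = (b + a11 * x + a12 * y, a21 * x + a22 * y)"
  shows "X_origin F = b" "Yx_origin F = a21" "snd (F (0, 0)) = 0"
proof -
  have "((\<lambda>x. a21 * x) has_field_derivative a21) (at 0)"
    by (auto intro!: derivative_eq_intros)
  then show "Yx_origin F = a21"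
    using assms by (simp add: Yx_origin_def DERIV_imp_deriv)
qed (use assms in \<open>simp_all add: X_origin_def\<close>)

lemma VV1_VI3_affine:
  fixes Ap Am :: "real^2^2"
  assumes "\<forall>x y. Fp (x, y) = (bp + Ap$1$1 * x + Ap$1$2 * y, Ap$2$1 * x + Ap$2$2 * y)"
    and "\<forall>x y. Fm (x, y) = (bm + Am$1$1 * x + Am$1$2 * y, Am$2$1 * x + Am$2$2 * y)"
    and "bp > 0" "Ap$2$1 > 0" "Am$2$1 < 0"
  shows "VV1 Fp Fm \<longleftrightarrow> bm > 0"
    and "VI3 Fp Fm \<longleftrightarrow> bm < 0 \<and> Delta bp Ap bm Am > 0"
  using origin_data_affine[OF assms(1)] origin_data_affine[OF assms(2)] assms(3-5)
  by (auto simp: VV1_def VI3_def two_fold_def fold_at_origin_def Delta_def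
      mult_less_0_iff zero_less_mult_iff)

lemma half_return_le: "half_return F H x x' \<Longrightarrow> x' \<le> 0 \<and> 0 \<le> x"
  by (simp add: half_return_def)

lemma maximal_domain_explicit:
  fixes Ap Am :: "real^2^2"
  assumes pos: "Delta bp Ap bm Am > 0" "Ap$2$1 - Am$2$1 > 0"
    and unique: "\<And>x x' x''. half_return F H x x' \<Longrightarrow> half_return F H x x'' \<Longrightarrow> x' = x''"
  defines "c \<equiv> C_const Ap Am" and "xs \<equiv> - Delta bp Ap bm Am / C_const Ap Am"
  shows "maximal_domain (sliding_field bp Ap bm Am) F H =
    (if c = 0 then half_map_domain F H
     else if xs > 0 then {x \<in> half_map_domain F H. x < xs}
     else {x \<in> half_map_domain F H. half_map F H x > xs})"
proof -
  let ?d = "Delta bp Ap bm Am"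
  have sgn: "half_map F H x \<le> 0 \<and> 0 \<le> x" if dom: "x \<in> half_map_domain F H" for x
  proof -
    obtain x' where x': "half_return F H x x'"
      using dom by (auto simp: half_map_domain_def)
    then have "half_map F H x = x'"
      unfolding half_map_def using unique by blast
    then show ?thesis using half_return_le[OF x'] by simp
  qed
  have zero: "sliding_field bp Ap bm Am u = 0 \<longleftrightarrow> c \<noteq> 0 \<and> u = xs" for u
  proof (cases "c = 0")
    case True
    then show ?thesis using pos by (simp add: sliding_field_def c_def)
  next
    case False
    have "?d + c * u = 0 \<longleftrightarrow> u = - ?d / c"
      using False by (simp add: field_simps) linarith
    then show ?thesis using pos False by (simp add: sliding_field_def c_def xs_def)
  qed
  have nz: "xs \<noteq> 0" if "c \<noteq> 0"
    using pos that by (simp add: xs_def c_def)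
  have mem: "x \<in> maximal_domain (sliding_field bp Ap bm Am) F H \<longleftrightarrow>
      x \<in> half_map_domain F H \<and> \<not> (c \<noteq> 0 \<and> half_map F H x \<le> xs \<and> xs \<le> x)" for x
    by (auto simp: maximal_domain_def zero)
  show ?thesis
  proof (intro set_eqI)
    fix x
    show "x \<in> maximal_domain (sliding_field bp Ap bm Am) F H \<longleftrightarrow>
      x \<in> (if c = 0 then half_map_domain F H
           else if xs > 0 then {x \<in> half_map_domain F H. x < xs}
           else {x \<in> half_map_domain F H. half_map F H x > xs})"
      using sgn[of x] nz by (auto simp: mem)
  qed
qed

end

theory Submission
  imports Defs
begin

text \<open>
  Dividing $y$ by $a_{2,1}$ turns either half-return into the first return to $0$ of a
  solution of $\eta'' = T\eta' - D\eta + b$ with $\eta'(0) = x$ and $\eta'(\tau) = x'$.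
  The solution is an explicit spiral, and comparing its phases at both ends gives
  $V(x') = V(x) + 2\pi\rho$, where $V'(u) = u/w(u)$ for a positive quadratic $w$, and $\rho$
  has the sign of $T$.  Moreover $x + x'$ has the sign of $-\rho$.

  With $L(u) = \Delta + Cu$ this yields that $I'$ is a positive multiple of
  $w(x)L(x') - w(x')L(x) = (x - x')B(x)$, and at a zero of $B$ one has
  $B' = L(x')(x + x')/x'$, which has the sign of $\rho$.  So $B$ changes sign at most once.
  If $C\rho < 0$, then $I$ has opposite signs at the two ends of its domain, and it has
  exactly one zero, which is simple.  Otherwise comparison with the symmetric interval
  $[-x, x]$ shows that $I$ has no zero, or that $I = 0$ if $C = \rho = 0$.
\<close>

text \<open>The half-map has no closed form, and the arctangent fixes a phase only up to full turns.
  So it has to be proved that the first return comes exactly one turn later, and conversely that the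
  one-turn arc stays on its side of the line y = 0. Afterwards only the relation between the two
  potentials is used. The strict sign of x + x' comes from a factor 2: reflecting a point at 0, on
  the side where it matters, raises V by at most pi |rho|, while the return relation shifts V by 2
  pi rho. B contains x', so its sign cannot be read off directly. Only at its zeros does w cancel
  from B', which is why the argument goes through upcrossings. The opposite signs of I have two
  different causes. At one end of the domain one of the arms [x', 0] and [0, x] has shrunk to a
  point, so u has constant sign; at the other end L tends to 0 and the integral diverges
  logarithmically. For rho > 0 > C these ends are x = 0 and x = -Delta/C; for rho < 0 < C they are
  x' = 0 and x' = -Delta/C, with both signs reversed.\<close>

section \<open>The potential of a spiral\<close>

text \<open>
  At \<open>\<eta> = 0\<close>, \<open>\<eta>' = x\<close> the spiral has the phase \<open>\<psi> = arctan (\<rho> + x / m)\<close> modulo \<open>2 * pi\<close>, and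
  the potential is the negative logarithm of \<open>exp (\<rho> * \<psi>) * cos \<psi>\<close>.
\<close>
definition spiral_potential :: "real \<Rightarrow> real \<Rightarrow> real \<Rightarrow> real" where
  "spiral_potential \<rho> m x = ln (1 + (\<rho> + x / m)\<^sup>2) / 2 - \<rho> * arctan (\<rho> + x / m)"

lemma exp_minus_spiral_potential:
  "exp (- spiral_potential \<rho> m x) =
     exp (\<rho> * arctan (\<rho> + x / m)) * cos (arctan (\<rho> + x / m))"
proof -
  have "1 + (\<rho> + x / m)\<^sup>2 > 0"
    by (simp add: add_pos_nonneg)
  then have "exp (- (ln (1 + (\<rho> + x / m)\<^sup>2) / 2)) = cos (arctan (\<rho> + x / m))"
    by (simp add: cos_arctan exp_minus ln_sqrt[symmetric] inverse_eq_divide)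
  moreover have "- spiral_potential \<rho> m x =
      \<rho> * arctan (\<rho> + x / m) + - (ln (1 + (\<rho> + x / m)\<^sup>2) / 2)"
    by (simp add: spiral_potential_def)
  ultimately show ?thesis
    by (simp only: exp_add)
qed

text \<open>In the variable q = \<open>\<rho> + x / m\<close> the derivative is
  \<open>(q - \<rho>) / (1 + q\<^sup>2)\<close>, and the numerator is x / m, so the fold x = 0 is
  the only critical point. For a focus with determinant D, trace T and constant term b, the
  denominator is (D x^2 + T b x + b^2) / D.\<close>

lemma spiral_potential_has_derivative:
  assumes "m \<noteq> 0"
  shows "(spiral_potential \<rho> m has_real_derivative x / (m\<^sup>2 + (\<rho> * m + x)\<^sup>2)) (at x)"
proof -
  let ?q = "\<rho> + x / m"
  have pos: "1 + ?q\<^sup>2 > 0" by (simp add: add_pos_nonneg)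
  have "((\<lambda>q. ln (1 + q\<^sup>2) / 2 - \<rho> * arctan q) has_real_derivative
      (q - \<rho>) / (1 + q\<^sup>2)) (at q)" for q
  proof -
    have "1 + q\<^sup>2 > 0" by (simp add: add_pos_nonneg)
    then show ?thesis
      by (auto intro!: derivative_eq_intros simp: divide_simps) (simp add: algebra_simps)
  qed
  then have "((\<lambda>q. ln (1 + q\<^sup>2) / 2 - \<rho> * arctan q) has_real_derivative
      (?q - \<rho>) / (1 + ?q\<^sup>2)) (at ?q)" .
  moreover have "((\<lambda>x. \<rho> + x / m) has_real_derivative 1 / m) (at x)"
    using assms by (auto intro!: derivative_eq_intros)
  ultimately have "(spiral_potential \<rho> m has_real_derivative
      (?q - \<rho>) / (1 + ?q\<^sup>2) * (1 / m)) (at x)"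
    unfolding spiral_potential_def[abs_def] by (rule DERIV_chain2)
  moreover have "(?q - \<rho>) / (1 + ?q\<^sup>2) * (1 / m) = (x / m\<^sup>2) / (1 + ?q\<^sup>2)"
    by (simp add: power2_eq_square)
  moreover have "m\<^sup>2 + (\<rho> * m + x)\<^sup>2 = m\<^sup>2 * (1 + ?q\<^sup>2)"
    using assms by (simp add: field_simps power2_eq_square)
  ultimately show ?thesis by (simp only: divide_divide_eq_left)
qed

lemma spiral_potential_denominator_pos:
  "m \<noteq> 0 \<Longrightarrow> (m::real)\<^sup>2 + (\<rho> * m + x)\<^sup>2 > 0"
  by (simp add: add_pos_nonneg)

lemma spiral_potential_strict_mono:
  assumes "m > 0" "0 \<le> x" "x < y"
  shows "spiral_potential \<rho> m x < spiral_potential \<rho> m y"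
proof (rule DERIV_pos_imp_increasing_open[OF \<open>x < y\<close>])
  show "\<exists>d. (spiral_potential \<rho> m has_real_derivative d) (at u) \<and> d > 0" if "x < u" "u < y" for u
    using spiral_potential_has_derivative[of m \<rho> u] spiral_potential_denominator_pos[of m \<rho> u] assms that
    by (intro exI[of _ "u / (m\<^sup>2 + (\<rho> * m + u)\<^sup>2)"]) auto
  show "continuous_on {x..y} (spiral_potential \<rho> m)"
    using spiral_potential_has_derivative[of m \<rho>] assms
    by (intro continuous_at_imp_continuous_on) (auto intro: DERIV_isCont)
qed

lemma spiral_potential_strict_antimono:
  assumes "m > 0" "y \<le> 0" "x < y"
  shows "spiral_potential \<rho> m y < spiral_potential \<rho> m x"
proof (rule DERIV_neg_imp_decreasing_open[OF \<open>x < y\<close>])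
  show "\<exists>d. (spiral_potential \<rho> m has_real_derivative d) (at u) \<and> d < 0" if "x < u" "u < y" for u
    using spiral_potential_has_derivative[of m \<rho> u] spiral_potential_denominator_pos[of m \<rho> u] assms that
    by (intro exI[of _ "u / (m\<^sup>2 + (\<rho> * m + u)\<^sup>2)"]) (auto simp: divide_neg_pos)
  show "continuous_on {x..y} (spiral_potential \<rho> m)"
    using spiral_potential_has_derivative[of m \<rho>] assms
    by (intro continuous_at_imp_continuous_on) (auto intro: DERIV_isCont)
qed

section \<open>Explicit solutions of the affine field\<close>

text \<open>Rotating back by \<open>\<omega> * t\<close> and rescaling by
  \<open>exp (- \<sigma> * t)\<close> undoes the flow: the resulting \<open>f\<close> and
  \<open>g\<close> have derivative 0. No uniqueness theorem for differential equations is called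
  for.\<close>

lemma linear_spiral_solution:
  fixes u v :: "real \<Rightarrow> real"
  assumes u: "\<And>t. t \<in> {0..\<tau>} \<Longrightarrow>
      (u has_real_derivative \<sigma> * u t + \<omega> * v t) (at t within {0..\<tau>})"
    and v: "\<And>t. t \<in> {0..\<tau>} \<Longrightarrow>
      (v has_real_derivative \<sigma> * v t - \<omega> * u t) (at t within {0..\<tau>})"
    and t: "t \<in> {0..\<tau>}"
  shows "u t = exp (\<sigma> * t) * (u 0 * cos (\<omega> * t) + v 0 * sin (\<omega> * t))"
    and "v t = exp (\<sigma> * t) * (v 0 * cos (\<omega> * t) - u 0 * sin (\<omega> * t))"
proof -
  define f where "f t = exp (- \<sigma> * t) * (u t * cos (\<omega> * t) - v t * sin (\<omega> * t))" for t
  define g where "g t = exp (- \<sigma> * t) * (u t * sin (\<omega> * t) + v t * cos (\<omega> * t))" for t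
  have "(f has_real_derivative 0) (at t within {0..\<tau>})" if "t \<in> {0..\<tau>}" for t
    unfolding f_def
    by (rule derivative_eq_intros u[OF that] v[OF that] refl)+ (simp add: algebra_simps)
  then obtain c where c: "\<And>t. t \<in> {0..\<tau>} \<Longrightarrow> f t = c"
    using has_field_derivative_zero_constant[of "{0..\<tau>}" f] by auto
  have "(g has_real_derivative 0) (at t within {0..\<tau>})" if "t \<in> {0..\<tau>}" for t
    unfolding g_def
    by (rule derivative_eq_intros u[OF that] v[OF that] refl)+ (simp add: algebra_simps)
  then obtain d where d: "\<And>t. t \<in> {0..\<tau>} \<Longrightarrow> g t = d"
    using has_field_derivative_zero_constant[of "{0..\<tau>}" g] by auto
  have "0 \<in> {0..\<tau>}" using t by simp
  then have fg: "f t = u 0" "g t = v 0"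
    using c[of t] c[of 0] d[of t] d[of 0] t by (auto simp: f_def g_def)
  have e: "exp (\<sigma> * t) * exp (- \<sigma> * t) = 1"
    by (simp flip: exp_add)
  have "f t * cos (\<omega> * t) + g t * sin (\<omega> * t) =
      exp (- \<sigma> * t) * (u t * ((sin (\<omega> * t))\<^sup>2 + (cos (\<omega> * t))\<^sup>2))"
    unfolding f_def g_def by (simp only: power2_eq_square) algebra
  then have "exp (\<sigma> * t) * (f t * cos (\<omega> * t) + g t * sin (\<omega> * t)) =
      exp (\<sigma> * t) * exp (- \<sigma> * t) * u t"
    by (simp only: sin_cos_squared_add mult.assoc mult_1_right)
  then show "u t = exp (\<sigma> * t) * (u 0 * cos (\<omega> * t) + v 0 * sin (\<omega> * t))"
    unfolding fg e by simp
  have "g t * cos (\<omega> * t) - f t * sin (\<omega> * t) =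
      exp (- \<sigma> * t) * (v t * ((sin (\<omega> * t))\<^sup>2 + (cos (\<omega> * t))\<^sup>2))"
    unfolding f_def g_def by (simp only: power2_eq_square) algebra
  then have "exp (\<sigma> * t) * (g t * cos (\<omega> * t) - f t * sin (\<omega> * t)) =
      exp (\<sigma> * t) * exp (- \<sigma> * t) * v t"
    by (simp only: sin_cos_squared_add mult.assoc mult_1_right)
  then show "v t = exp (\<sigma> * t) * (v 0 * cos (\<omega> * t) - u 0 * sin (\<omega> * t))"
    unfolding fg e by simp
qed

text \<open>Polar form for the initial value (-s, s q): since \<open>tan \<alpha> = q\<close>, the
  amplitude is \<open>s / cos \<alpha>\<close> and the initial phase is
  \<open>\<alpha>\<close>.\<close>

lemma spiral_phase_form:
  fixes q s :: real
  defines "\<alpha> \<equiv> arctan q"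
  shows "exp (\<sigma> * t) * (- s * cos (\<omega> * t) + s * q * sin (\<omega> * t)) =
      - (s / cos \<alpha>) * exp (\<sigma> * t) * cos (\<omega> * t + \<alpha>)"
    and "exp (\<sigma> * t) * (s * q * cos (\<omega> * t) - (- s) * sin (\<omega> * t)) =
      (s / cos \<alpha>) * exp (\<sigma> * t) * sin (\<omega> * t + \<alpha>)"
proof -
  have "cos \<alpha> \<noteq> 0" "q = sin \<alpha> / cos \<alpha>"
    using cos_arctan_not_zero[of q] tan_arctan[of q] by (auto simp: \<alpha>_def tan_def)
  then show "exp (\<sigma> * t) * (- s * cos (\<omega> * t) + s * q * sin (\<omega> * t)) =
      - (s / cos \<alpha>) * exp (\<sigma> * t) * cos (\<omega> * t + \<alpha>)"
    and "exp (\<sigma> * t) * (s * q * cos (\<omega> * t) - (- s) * sin (\<omega> * t)) =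
      (s / cos \<alpha>) * exp (\<sigma> * t) * sin (\<omega> * t + \<alpha>)"
    by (simp_all add: cos_add sin_add field_simps)
qed

text \<open>At the return the first coordinate is again -s, so the phase has positive cosine and
  tangent q. The sign of the cosine excludes half turns.\<close>

lemma arctan_phase_unique:
  fixes \<beta> q k :: real
  assumes "k > 0" "k * cos \<beta> = 1" "k * sin \<beta> = q"
  obtains n :: int where "\<beta> = arctan q + 2 * pi * n"
proof -
  have c: "cos \<beta> = 1 / k" and s: "sin \<beta> = q / k"
    using assms by (auto simp: field_simps)
  have "1 + q\<^sup>2 = k\<^sup>2"
    using sin_cos_squared_add[of \<beta>] assms(1) unfolding c s by (simp add: field_simps)
  then have "sqrt (1 + q\<^sup>2) = k" using assms(1) by simp
  then have "sin \<beta> = sin (arctan q) \<and> cos \<beta> = cos (arctan q)"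
    using c s by (simp add: sin_arctan cos_arctan)
  then show thesis using that sin_cos_eq_iff[of \<beta> "arctan q"] by auto
qed

section \<open>First returns in terms of phases\<close>

context
  fixes \<rho> m x x' :: real
  assumes m: "m > 0"
begin

abbreviation (input) "ph u \<equiv> arctan (\<rho> + u / m)"

lemma phase_mono: "u \<le> v \<Longrightarrow> ph u \<le> ph v"
  using m by (simp add: arctan_le_iff divide_right_mono)

text \<open>Since \<open>ph x' \<le> ph x < \<beta>\<close>, there is at least one full turn, and
  \<open>before\<close> excludes a second one. With one turn,
  \<open>exp (\<rho> * \<psi>) * cos \<psi>\<close> at \<open>ph x\<close> is its value at
  \<open>ph x'\<close> times \<open>exp (2 * pi * \<rho>)\<close>; logarithms give the
  potentials.\<close>

lemma first_return_potential:
  assumes x: "0 \<le> x" "x' \<le> 0"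
    and n: "\<beta> = ph x' + 2 * pi * real_of_int n" "ph x < \<beta>"
    and ret: "exp (\<rho> * (\<beta> - ph x)) * cos \<beta> = cos (ph x)"
    and before: "\<And>\<psi>. ph x < \<psi> \<Longrightarrow> \<psi> < \<beta> \<Longrightarrow> exp (\<rho> * (\<psi> - ph x)) * cos \<psi> < cos (ph x)"
  shows "spiral_potential \<rho> m x' = spiral_potential \<rho> m x + 2 * pi * \<rho>"
proof -
  have bd: "- (pi/2) < ph u" "ph u < pi/2" for u
    using arctan_lbound arctan_ubound by auto
  have cpos: "cos (ph u) > 0" for u by (simp add: cos_arctan add_pos_nonneg)
  have cosn: "cos (u + 2 * pi * real_of_int n) = cos u" for u n
    using sin_cos_eq_iff[of "u + 2 * pi * real_of_int n" u] by auto
  have le: "ph x' \<le> ph x" using x phase_mono by simp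
  have npos: "n > 0"
  proof (rule ccontr)
    assume "\<not> n > 0"
    then have "2 * pi * real_of_int n \<le> 0" by (simp add: mult_nonneg_nonpos)
    then show False using n le by simp
  qed
  have "n = 1"
  proof (rule ccontr)
    assume "n \<noteq> 1"
    then have "n \<ge> 2" using npos by simp
    \<comment> \<open>Positivity at the phase \<open>2 * pi + ph x'\<close> forces \<open>\<rho> > 0\<close>, and at \<open>2 * pi + ph x\<close> it forces
      \<open>\<rho> < 0\<close>.\<close>
    then have n2: "2 * pi * real_of_int n \<ge> 2 * pi * 2" by (intro mult_left_mono) auto
    have "exp (\<rho> * (2 * pi + ph x' - ph x)) * cos (ph x') < cos (ph x)"
      using before[of "2 * pi + ph x'"] n n2 bd[of x] bd[of x'] cosn[of "ph x'" 1]
      by (simp add: add.commute)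
    moreover have "exp (\<rho> * (2 * pi * real_of_int n + ph x' - ph x)) * cos (ph x') = cos (ph x)"
      using ret n cosn[of "ph x'" n] by (simp add: algebra_simps)
    ultimately have "exp (\<rho> * (2 * pi + ph x' - ph x)) * cos (ph x') <
        exp (\<rho> * (2 * pi * real_of_int n + ph x' - ph x)) * cos (ph x')" by simp
    then have "exp (\<rho> * (2 * pi + ph x' - ph x)) < exp (\<rho> * (2 * pi * real_of_int n + ph x' - ph x))"
      using cpos[of x'] by (simp only: mult_less_cancel_right_pos)
    then have "\<rho> * (2 * pi) < \<rho> * (2 * pi * real_of_int n)"
      by (simp add: algebra_simps)
    moreover have "2 * pi \<le> 2 * pi * real_of_int n" using n2 pi_gt_zero by linarith
    ultimately have "\<rho> > 0"
      using mult_left_mono_neg[of "2 * pi" "2 * pi * real_of_int n" \<rho>] by linarith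
    have "exp (\<rho> * (2 * pi)) * cos (ph x) < cos (ph x)"
      using before[of "2 * pi + ph x"] n n2 bd[of x] bd[of x'] cosn[of "ph x" 1]
      by (simp add: add.commute)
    then have "exp (\<rho> * (2 * pi)) < 1"
      using cpos[of x] by simp
    then have "\<rho> * (2 * pi) < 0" by simp
    then show False using mult_pos_pos[OF \<open>\<rho> > 0\<close>, of "2 * pi"] by simp
  qed
  then have "exp (\<rho> * (2 * pi + ph x' - ph x)) * cos (ph x') = cos (ph x)"
    using ret n cosn[of "ph x'" 1] by (simp add: algebra_simps)
  then have "exp (2 * pi * \<rho>) * (exp (\<rho> * ph x') * cos (ph x')) = exp (\<rho> * ph x) * cos (ph x)"
    by (simp add: algebra_simps exp_add exp_diff divide_eq_eq)
  then have "exp (2 * pi * \<rho> + - spiral_potential \<rho> m x') = exp (- spiral_potential \<rho> m x)"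
    by (simp only: exp_add exp_minus_spiral_potential)
  then show ?thesis by (subst (asm) exp_inj_iff) simp
qed

text \<open>The arc is split where the cosine changes sign. Before pi/2 the phase is
  \<open>ph u\<close> with u > x, and V increases on the right of 0; up to 3 pi/2 the cosine is not
  positive; after that the phase is \<open>ph u + 2 * pi\<close> with u < x', and V decreases on the
  left of 0.\<close>

lemma potential_first_return:
  assumes x: "0 \<le> x" "x' \<le> 0"
    and pot: "spiral_potential \<rho> m x' = spiral_potential \<rho> m x + 2 * pi * \<rho>"
  shows "exp (\<rho> * (2 * pi + ph x' - ph x)) * cos (ph x') = cos (ph x)"
    and "ph x < \<psi> \<Longrightarrow> \<psi> < 2 * pi + ph x' \<Longrightarrow> exp (\<rho> * (\<psi> - ph x)) * cos \<psi> < cos (ph x)"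
proof -
  have bd: "- (pi/2) < ph u" "ph u < pi/2" for u
    using arctan_lbound arctan_ubound by auto
  have cpos: "cos (ph u) > 0" for u by (simp add: cos_arctan add_pos_nonneg)
  have "exp (2 * pi * \<rho> + - spiral_potential \<rho> m x') = exp (- spiral_potential \<rho> m x)"
    using pot by simp
  then have eq: "exp (2 * pi * \<rho>) * (exp (\<rho> * ph x') * cos (ph x')) = exp (\<rho> * ph x) * cos (ph x)"
    by (simp only: exp_add exp_minus_spiral_potential)
  then show "exp (\<rho> * (2 * pi + ph x' - ph x)) * cos (ph x') = cos (ph x)"
    by (simp add: algebra_simps exp_add exp_diff)
  have inv: "\<exists>u. ph u = \<theta>" if "- (pi/2) < \<theta>" "\<theta> < pi/2" for \<theta>
    using that m by (intro exI[of _ "m * (tan \<theta> - \<rho>)"]) (simp add: arctan_tan)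
  have cmp: "exp (\<rho> * ph u) * cos (ph u) < exp (\<rho> * ph v) * cos (ph v)"
    if "spiral_potential \<rho> m v < spiral_potential \<rho> m u" for u v
  proof -
    have "exp (- spiral_potential \<rho> m u) < exp (- spiral_potential \<rho> m v)" using that by simp
    then show ?thesis by (simp only: exp_minus_spiral_potential)
  qed
  assume \<psi>: "ph x < \<psi>" "\<psi> < 2 * pi + ph x'"
  have "exp (\<rho> * \<psi>) * cos \<psi> < exp (\<rho> * ph x) * cos (ph x)"
  proof (cases "\<psi> < pi/2")
    case True
    then obtain u where u: "ph u = \<psi>" using inv[of \<psi>] \<psi> bd[of x] by auto
    then have "x < u" using \<psi>(1) phase_mono[of u x] by linarith
    then show ?thesis
      using cmp[of x u] spiral_potential_strict_mono[OF m x(1)] u by auto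
  next
    case False
    show ?thesis
    proof (cases "\<psi> \<le> 3 * pi / 2")
      case True
      have "cos (\<psi> - pi) \<ge> 0" using False True by (intro cos_ge_zero) auto
      then have "cos \<psi> \<le> 0" by (simp add: cos_diff)
      then have "exp (\<rho> * \<psi>) * cos \<psi> \<le> 0" by (simp add: mult_nonneg_nonpos)
      moreover have "exp (\<rho> * ph x) * cos (ph x) > 0" using cpos[of x] by simp
      ultimately show ?thesis by linarith
    next
      case False
      then obtain u where u: "ph u = \<psi> - 2 * pi" using inv[of "\<psi> - 2 * pi"] \<psi> bd[of x'] by auto
      then have "u < x'" using \<psi>(2) phase_mono[of x' u] by linarith
      then have "exp (\<rho> * ph u) * cos (ph u) < exp (\<rho> * ph x') * cos (ph x')"
        using cmp[of x' u] spiral_potential_strict_antimono[OF m x(2)] by auto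
      then have "exp (2 * pi * \<rho>) * (exp (\<rho> * ph u) * cos (ph u)) < exp (\<rho> * ph x) * cos (ph x)"
        unfolding eq[symmetric] by (intro mult_strict_left_mono) auto
      then show ?thesis
        unfolding u by (simp add: algebra_simps exp_diff cos_diff)
    qed
  qed
  then show "exp (\<rho> * (\<psi> - ph x)) * cos \<psi> < cos (ph x)"
    by (simp add: algebra_simps exp_diff field_simps)
qed

end


text \<open>The product \<open>a21 * snd p\<close> makes one equivalence serve both half-planes. At
  phase \<open>\<psi> = \<omega> * t + \<alpha>\<close> the orbit lies in the set iff \<open>exp
  (\<rho> * (\<psi> - \<alpha>)) * cos \<psi> < cos \<alpha>\<close>, which is the hypothesis
  \<open>before\<close> of the phase lemmas.\<close>

theorem half_return_iff:
  fixes F :: "real \<times> real \<Rightarrow> real \<times> real"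
  assumes F: "\<And>x y. F (x, y) = (b + a11 * x + a12 * y, a21 * x + a22 * y)"
    and tr: "a11 + a22 = 2 * \<sigma>" and dt: "a11 * a22 - a12 * a21 = \<sigma>\<^sup>2 + \<omega>\<^sup>2"
    and b: "b = s * (\<sigma>\<^sup>2 + \<omega>\<^sup>2)"
    and pos: "s > 0" "\<omega> > 0" and a21: "a21 \<noteq> 0"
  defines "\<rho> \<equiv> \<sigma> / \<omega>" and "m \<equiv> \<omega> * s"
  shows "half_return F {p. 0 < a21 * snd p} x x' \<longleftrightarrow>
    0 \<le> x \<and> x' \<le> 0 \<and> spiral_potential \<rho> m x' = spiral_potential \<rho> m x + 2 * pi * \<rho>"
proof -
  define q where "q u = \<rho> + u / m" for u
  define \<alpha> where "\<alpha> = arctan (q x)"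
  have m: "m > 0" using pos by (simp add: m_def)
  have \<sigma>: "\<sigma> = \<rho> * \<omega>" using pos by (simp add: \<rho>_def)
  have sq: "s * q u = (u + \<sigma> * s) / \<omega>" for u
    using pos by (simp add: q_def \<rho>_def m_def field_simps)
  have c\<alpha>: "cos \<alpha> > 0" by (simp add: \<alpha>_def cos_arctan add_pos_nonneg)
  have \<sigma>t: "\<sigma> * t = \<rho> * ((\<omega> * t + \<alpha>) - \<alpha>)" for t by (simp add: \<sigma>)
  show ?thesis
  proof
    assume "half_return F {p. 0 < a21 * snd p} x x'"
    then obtain \<tau> \<gamma> where x: "0 \<le> x" "x' \<le> 0" and \<tau>: "\<tau> > 0"
      and \<gamma>: "\<gamma> 0 = (x, 0)" "\<gamma> \<tau> = (x', 0)"
      and D: "\<And>t. t \<in> {0..\<tau>} \<Longrightarrow> (\<gamma> has_vector_derivative F (\<gamma> t)) (at t within {0..\<tau>})"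
      and up: "\<And>t. 0 < t \<Longrightarrow> t < \<tau> \<Longrightarrow> 0 < a21 * snd (\<gamma> t)"
      unfolding half_return_def by auto
    \<comment> \<open>With eta = y / a21, \<open>u\<close> is the displacement of eta from its
      equilibrium value s = b / D, and \<open>v\<close> is chosen so that u' =
      \<open>\<sigma> * u + \<omega> * v\<close>.\<close>
    define u where "u t = snd (\<gamma> t) / a21 - s" for t
    define v where "v t = (fst (\<gamma> t) + a22 * (snd (\<gamma> t) / a21) - \<sigma> * u t) / \<omega>" for t
    have DX: "((\<lambda>t. fst (\<gamma> t)) has_real_derivative b + a11 * fst (\<gamma> t) + a12 * snd (\<gamma> t)) (at t within {0..\<tau>})"
      and DY: "((\<lambda>t. snd (\<gamma> t)) has_real_derivative a21 * fst (\<gamma> t) + a22 * snd (\<gamma> t)) (at t within {0..\<tau>})"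
      if "t \<in> {0..\<tau>}" for t
      using bounded_linear.has_vector_derivative[OF bounded_linear_fst D[OF that]]
        bounded_linear.has_vector_derivative[OF bounded_linear_snd D[OF that]]
        F[of "fst (\<gamma> t)" "snd (\<gamma> t)"]
      by (simp_all add: has_real_derivative_iff_has_vector_derivative)
    have Du: "(u has_real_derivative \<sigma> * u t + \<omega> * v t) (at t within {0..\<tau>})" if "t \<in> {0..\<tau>}" for t
      unfolding u_def[abs_def]
      by (rule derivative_eq_intros DY[OF that] refl a21)+
         (use pos a21 in \<open>simp add: v_def u_def field_simps\<close>)
    have Dv: "(v has_real_derivative \<sigma> * v t - \<omega> * u t) (at t within {0..\<tau>})" if "t \<in> {0..\<tau>}" for t
    proof -
      let ?X = "fst (\<gamma> t)" and ?Y = "snd (\<gamma> t)"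
      have "(v has_real_derivative
          ((b + a11 * ?X + a12 * ?Y) + a22 * ((a21 * ?X + a22 * ?Y) / a21)
             - \<sigma> * (\<sigma> * u t + \<omega> * v t)) / \<omega>) (at t within {0..\<tau>})"
        unfolding v_def[abs_def]
        by (rule derivative_eq_intros DX[OF that] DY[OF that] Du[OF that] refl a21 | (use pos a21 in simp; fail))+
           (use pos a21 in \<open>simp add: v_def\<close>)
      moreover have "((b + a11 * ?X + a12 * ?Y) + a22 * ((a21 * ?X + a22 * ?Y) / a21)
             - \<sigma> * (\<sigma> * u t + \<omega> * v t)) / \<omega> = \<sigma> * v t - \<omega> * u t"
      proof -
        define h where "h = ?Y / a21"
        have Y: "?Y = a21 * h" using a21 by (simp add: h_def)
        have V: "\<omega> * v t = ?X + a22 * h - \<sigma> * u t"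
          using pos by (simp add: v_def h_def)
        have U: "u t = h - s" by (simp add: u_def h_def)
        have "(b + a11 * ?X + a12 * ?Y) + a22 * ((a21 * ?X + a22 * ?Y) / a21) =
            b + (a11 + a22) * (?X + a22 * h) - (a11 * a22 - a12 * a21) * h"
          unfolding Y using a21 by (simp add: field_simps)
        also have "\<dots> = 2 * \<sigma> * (?X + a22 * h) - (\<sigma>\<^sup>2 + \<omega>\<^sup>2) * u t"
          unfolding tr dt b U by (simp add: algebra_simps)
        also have "\<dots> - \<sigma> * (\<sigma> * u t + \<omega> * v t) = \<omega> * (\<sigma> * v t - \<omega> * u t)"
          using V by (simp add: power2_eq_square) algebra
        finally show ?thesis using pos by (simp add: divide_eq_eq mult.commute)
      qed
      ultimately show ?thesis by simp
    qed
    have u0: "u 0 = - s" "v 0 = s * q x" and u1: "u \<tau> = - s" "v \<tau> = s * q x'"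
      using \<gamma> by (simp_all add: u_def v_def sq)
    have ut: "u t = - (s / cos \<alpha>) * exp (\<sigma> * t) * cos (\<omega> * t + \<alpha>)"
      and vt: "v t = (s / cos \<alpha>) * exp (\<sigma> * t) * sin (\<omega> * t + \<alpha>)" if "t \<in> {0..\<tau>}" for t
      using linear_spiral_solution[OF Du Dv that] spiral_phase_form[where \<sigma> = \<sigma> and t = t and s = s and \<omega> = \<omega> and q = "q x"]
      unfolding u0 \<alpha>_def by simp_all
    define \<beta> where "\<beta> = \<omega> * \<tau> + \<alpha>"
    have "s * (exp (\<rho> * (\<beta> - \<alpha>)) / cos \<alpha> * cos \<beta>) = s * 1"
      and "s * (exp (\<rho> * (\<beta> - \<alpha>)) / cos \<alpha> * sin \<beta>) = s * q x'"
      using ut[of \<tau>] vt[of \<tau>] \<tau> u1 unfolding \<sigma>t \<beta>_def by simp_all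
    then have ret: "exp (\<rho> * (\<beta> - \<alpha>)) / cos \<alpha> * cos \<beta> = 1"
        "exp (\<rho> * (\<beta> - \<alpha>)) / cos \<alpha> * sin \<beta> = q x'"
      using pos(1) by (simp_all only: mult_cancel_left) auto
    obtain n where n: "\<beta> = arctan (q x') + 2 * pi * real_of_int n"
      using arctan_phase_unique[OF _ ret] c\<alpha> by auto
    have "spiral_potential \<rho> m x' = spiral_potential \<rho> m x + 2 * pi * \<rho>"
    proof (rule first_return_potential[where \<rho> = \<rho>, OF m x, folded q_def, folded \<alpha>_def, OF n])
      show "\<alpha> < \<beta>" using \<tau> pos by (simp add: \<beta>_def)
      show "exp (\<rho> * (\<beta> - \<alpha>)) * cos \<beta> = cos \<alpha>"
        using ret(1) c\<alpha> by (simp add: field_simps)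
      fix \<psi> assume \<psi>: "\<alpha> < \<psi>" "\<psi> < \<beta>"
      define t where "t = (\<psi> - \<alpha>) / \<omega>"
      have t: "0 < t" "t < \<tau>" and \<psi>t: "\<psi> = \<omega> * t + \<alpha>"
        using \<psi> pos by (auto simp: t_def \<beta>_def field_simps)
      have "0 < snd (\<gamma> t) / a21"
        using up[OF t] by (simp add: zero_less_divide_iff zero_less_mult_iff) auto
      then have "u t > - s" by (simp add: u_def)
      then have "s * (exp (\<rho> * (\<psi> - \<alpha>)) * cos \<psi> / cos \<alpha>) < s * 1"
        using ut[of t] t unfolding \<sigma>t \<psi>t by simp
      then show "exp (\<rho> * (\<psi> - \<alpha>)) * cos \<psi> < cos \<alpha>"
        using pos(1) c\<alpha> by (simp add: divide_less_eq)
    qed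
    then show "0 \<le> x \<and> x' \<le> 0 \<and> spiral_potential \<rho> m x' = spiral_potential \<rho> m x + 2 * pi * \<rho>"
      using x by simp
  next
    assume R: "0 \<le> x \<and> x' \<le> 0 \<and> spiral_potential \<rho> m x' = spiral_potential \<rho> m x + 2 * pi * \<rho>"
    \<comment> \<open>Exactly one full turn ahead of the phase of \<open>x'\<close>.\<close>
    define \<beta> where "\<beta> = 2 * pi + arctan (q x')"
    have ret: "exp (\<rho> * (\<beta> - \<alpha>)) * cos \<beta> = cos \<alpha>"
      and before: "\<alpha> < \<psi> \<Longrightarrow> \<psi> < \<beta> \<Longrightarrow> exp (\<rho> * (\<psi> - \<alpha>)) * cos \<psi> < cos \<alpha>" for \<psi>
      using potential_first_return[OF m, of x x' \<rho>] R
      by (simp_all add: q_def \<alpha>_def \<beta>_def cos_add)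
    have "\<alpha> < \<beta>"
      using arctan_lbound[of "q x'"] arctan_ubound[of "q x"] pi_gt_zero unfolding \<alpha>_def \<beta>_def by linarith
    define \<tau> where "\<tau> = (\<beta> - \<alpha>) / \<omega>"
    have \<tau>: "\<tau> > 0" "\<omega> * \<tau> + \<alpha> = \<beta>" using \<open>\<alpha> < \<beta>\<close> pos by (auto simp: \<tau>_def)
    define u where "u t = - (s / cos \<alpha>) * exp (\<sigma> * t) * cos (\<omega> * t + \<alpha>)" for t
    define v where "v t = (s / cos \<alpha>) * exp (\<sigma> * t) * sin (\<omega> * t + \<alpha>)" for t
    \<comment> \<open>Inverts the change of coordinates: eta = u + s, the first coordinate is eta' -
      a22 eta, and the second is a21 eta.\<close>
    define \<gamma> where "\<gamma> t = (\<sigma> * u t + \<omega> * v t - a22 * (u t + s), a21 * (u t + s))" for t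
    have Du: "(u has_real_derivative \<sigma> * u t + \<omega> * v t) (at t within S)" for t S
      unfolding u_def[abs_def] v_def
      by (rule derivative_eq_intros refl)+ (simp add: algebra_simps)
    have Dv: "(v has_real_derivative \<sigma> * v t - \<omega> * u t) (at t within S)" for t S
      unfolding v_def[abs_def] u_def
      by (rule derivative_eq_intros refl)+ (simp add: algebra_simps)
    have tanq: "sin (arctan (q y)) = q y * cos (arctan (q y))" for y
      using tan_arctan[of "q y"] cos_arctan_not_zero[of "q y"] by (simp add: tan_def divide_eq_eq)
    have u0: "u 0 = - s" and v0: "\<omega> * v 0 = x + \<sigma> * s"
    proof -
      show "u 0 = - s" using c\<alpha> by (simp add: u_def)
      have "v 0 = s * q x" using c\<alpha> tanq[of x] by (simp add: v_def \<alpha>_def)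
      then show "\<omega> * v 0 = x + \<sigma> * s" using sq[of x] pos by simp
    qed
    have u1: "u \<tau> = - s" and v1: "\<omega> * v \<tau> = x' + \<sigma> * s"
    proof -
      show u1: "u \<tau> = - s" using ret c\<alpha> by (simp add: u_def \<sigma>t \<tau>(2) mult.assoc)
      have "sin \<beta> = q x' * cos \<beta>" using tanq[of x'] by (simp add: \<beta>_def sin_add cos_add)
      then have "v \<tau> = - u \<tau> * q x'" by (simp add: v_def u_def \<tau>(2))
      then show "\<omega> * v \<tau> = x' + \<sigma> * s" using u1 sq[of x'] pos by simp
    qed
    have "(\<gamma> has_vector_derivative F (\<gamma> t)) (at t within {0..\<tau>})" for t
    proof -
      have "((\<lambda>t. \<sigma> * u t + \<omega> * v t - a22 * (u t + s)) has_real_derivative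
          \<sigma> * (\<sigma> * u t + \<omega> * v t) + \<omega> * (\<sigma> * v t - \<omega> * u t) - a22 * (\<sigma> * u t + \<omega> * v t)) (at t within {0..\<tau>})"
        by (rule derivative_eq_intros Du Dv refl)+ simp
      moreover have "\<sigma> * (\<sigma> * u t + \<omega> * v t) + \<omega> * (\<sigma> * v t - \<omega> * u t) - a22 * (\<sigma> * u t + \<omega> * v t) =
          fst (F (\<gamma> t))"
        unfolding \<gamma>_def F fst_conv using tr dt b by algebra
      moreover have "((\<lambda>t. a21 * (u t + s)) has_real_derivative a21 * (\<sigma> * u t + \<omega> * v t)) (at t within {0..\<tau>})"
        by (rule derivative_eq_intros Du refl)+ simp
      moreover have "a21 * (\<sigma> * u t + \<omega> * v t) = snd (F (\<gamma> t))"
        unfolding \<gamma>_def F snd_conv by (simp add: algebra_simps)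
      ultimately have "((\<lambda>t. (\<sigma> * u t + \<omega> * v t - a22 * (u t + s), a21 * (u t + s)))
          has_vector_derivative (fst (F (\<gamma> t)), snd (F (\<gamma> t)))) (at t within {0..\<tau>})"
        unfolding has_real_derivative_iff_has_vector_derivative
        by (intro has_vector_derivative_Pair) simp_all
      then show ?thesis
        unfolding \<gamma>_def[abs_def, symmetric] prod.collapse .
    qed
    moreover have "\<gamma> 0 = (x, 0)" "\<gamma> \<tau> = (x', 0)"
      using u0 v0 u1 v1 by (simp_all add: \<gamma>_def)
    moreover have "\<gamma> t \<in> {p. 0 < a21 * snd p}" if "t \<in> {0<..<\<tau>}" for t
    proof -
      have "\<omega> * t < \<omega> * \<tau>" using that pos by simp
      then have "exp (\<rho> * (\<omega> * t + \<alpha> - \<alpha>)) * cos (\<omega> * t + \<alpha>) < cos \<alpha>"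
        using that pos \<tau>(2) by (intro before) auto
      then have "exp (\<sigma> * t) * cos (\<omega> * t + \<alpha>) / cos \<alpha> < 1"
        using c\<alpha> unfolding \<sigma>t by simp
      then have "s * (exp (\<sigma> * t) * cos (\<omega> * t + \<alpha>) / cos \<alpha>) < s * 1"
        using pos(1) by (rule mult_strict_left_mono)
      then have "u t + s > 0" by (simp add: u_def mult.assoc)
      then have "(a21 * a21) * (u t + s) > 0"
        using a21 not_real_square_gt_zero[of a21] by (intro mult_pos_pos[of "a21 * a21"]) blast+
      then show ?thesis by (simp add: \<gamma>_def mult.assoc)
    qed
    ultimately show "half_return F {p. 0 < a21 * snd p} x x'"
      unfolding half_return_def using R \<tau>(1) by blast
  qed
qed

section \<open>Sign changes and simple zeros of real functions\<close>

text \<open>Just left of a first later zero \<open>B\<close> would be negative, although it was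
  positive before; the intermediate value theorem then gives an even earlier zero.\<close>

lemma upcrossing:
  fixes B B' :: "real \<Rightarrow> real"
  assumes dB: "\<And>x. y \<le> x \<Longrightarrow> x \<le> z \<Longrightarrow> (B has_real_derivative B' x) (at x)"
    and up: "\<And>x. y \<le> x \<Longrightarrow> x \<le> z \<Longrightarrow> B x = 0 \<Longrightarrow> B' x > 0"
    and yz: "y < z" and By: "B y \<ge> 0"
  shows "B z > 0"
proof (rule ccontr)
  assume Bz: "\<not> B z > 0"
  \<comment> \<open>If \<open>B y = 0\<close>, the starting point is moved slightly to the right, so
    that the first later zero is distinct from it.\<close>
  obtain y1 where y1: "y \<le> y1" "y1 < z" "B y1 > 0"
  proof (cases "B y = 0")
    case True
    then obtain d where "d > 0" "\<And>h. 0 < h \<Longrightarrow> h < d \<Longrightarrow> B y < B (y + h)"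
      using DERIV_pos_inc_right[OF dB up] yz by (metis less_imp_le order_refl)
    then show thesis
      using that[of "y + min d (z - y) / 2"] True yz by (smt (verit) field_sum_of_halves min_def)
  qed (use that[of y] By yz in auto)
  have cont: "continuous_on {y1..z} B"
    using dB y1 by (intro DERIV_continuous_on[where D = B']) (auto intro: has_field_derivative_at_within)
  define S where "S = {x \<in> {y1..z}. B x = 0}"
  have "\<exists>x. y1 \<le> x \<and> x \<le> z \<and> B x = 0"
    using IVT2'[of B z 0 y1] cont Bz y1 by auto
  then have "S \<noteq> {}" by (auto simp: S_def)
  moreover have "compact S"
  proof -
    have "closed S"
      unfolding S_def using continuous_closed_preimage_constant[OF cont, of 0] by simp
    then have "compact ({y1..z} \<inter> S)" by (intro compact_Int_closed compact_Icc)
    moreover have "{y1..z} \<inter> S = S" by (auto simp: S_def)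
    ultimately show ?thesis by simp
  qed
  ultimately have "\<exists>x0\<in>S. \<forall>x\<in>S. x0 \<le> x"
    by (intro compact_attains_inf)
  then obtain x0 where x0: "x0 \<in> S" "\<And>x. x \<in> S \<Longrightarrow> x0 \<le> x"
    by blast
  have x0': "y1 < x0" "x0 \<le> z" "B x0 = 0" using x0(1) y1 by (auto simp: S_def less_le)
  obtain d where d: "d > 0" "\<And>h. 0 < h \<Longrightarrow> h < d \<Longrightarrow> B (x0 - h) < B x0"
    using DERIV_pos_inc_left[OF dB up, of x0] x0' y1 by auto
  define x1 where "x1 = x0 - min d (x0 - y1) / 2"
  have x1: "y1 < x1" "x1 < x0" using d(1) x0'(1) by (auto simp: x1_def min_def field_simps)
  have "B x1 < 0" using d(2)[of "x0 - x1"] x0' d(1) x1 by (auto simp: x1_def)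
  then have "\<exists>x. y1 \<le> x \<and> x \<le> x1 \<and> B x = 0"
    using IVT2'[of B x1 0 y1] continuous_on_subset[OF cont, of "{y1..x1}"] y1 x1 x0' by auto
  then show False using x0(2) x1 x0' by (fastforce simp: S_def)
qed

text \<open>If \<open>B z \<le> 0\<close> at a zero z of \<open>f\<close>, then \<open>B < 0\<close>
  on all of (a, z), and \<open>f\<close> would decrease from negative values to 0. So
  \<open>B z > 0\<close>; then \<open>B\<close> stays positive and \<open>f\<close> increases beyond
  z, which leaves no second zero.\<close>

lemma unique_simple_zero_of_upcrossing_derivative:
  fixes f h B B' :: "real \<Rightarrow> real"
  assumes df: "\<And>x. a < x \<Longrightarrow> x < e \<Longrightarrow> (f has_real_derivative h x * B x) (at x)"
    and h: "\<And>x. a < x \<Longrightarrow> x < e \<Longrightarrow> h x > 0"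
    and dB: "\<And>x. a < x \<Longrightarrow> x < e \<Longrightarrow> (B has_real_derivative B' x) (at x)"
    and up: "\<And>x. a < x \<Longrightarrow> x < e \<Longrightarrow> B x = 0 \<Longrightarrow> B' x > 0"
    and neg: "a < d" "d < e" "\<And>x. a < x \<Longrightarrow> x < d \<Longrightarrow> f x < 0"
    and pos: "a < y" "y < e" "f y > 0"
  obtains z where "a < z" "z < e" "f z = 0" "B z > 0"
    "\<And>x. a < x \<Longrightarrow> x < e \<Longrightarrow> f x = 0 \<Longrightarrow> x = z"
proof -
  have cross: "B v > 0" if "a < u" "u < v" "v < e" "B u \<ge> 0" for u v
    using that dB up by (intro upcrossing[of u v B B']) auto
  have cont: "continuous_on {u..v} f" if "a < u" "v < e" for u v
    using df that by (intro DERIV_continuous_on[where D = "\<lambda>x. h x * B x"])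
      (auto intro: has_field_derivative_at_within)
  have Bpos: "B z > 0" if z: "a < z" "z < e" "f z = 0" for z
  proof (rule ccontr)
    assume "\<not> B z > 0"
    then have Bneg: "B u < 0" if "a < u" "u < z" for u
      using cross[of u z] that z by (meson not_le)
    define u where "u = (a + min d z) / 2"
    have u: "a < u" "u < d" "u < z" using neg z by (auto simp: u_def min_def)
    have "f z < f u"
    proof (rule DERIV_neg_imp_decreasing_open[OF u(3)])
      show "\<exists>D. (f has_real_derivative D) (at x) \<and> D < 0" if "u < x" "x < z" for x
        using that u z df[of x] h[of x] Bneg[of x]
        by (intro exI[of _ "h x * B x"]) (auto simp: mult_pos_neg)
    qed (use cont u z in auto)
    then show False using neg(3)[of u] u z by simp
  qed
  have later: "f x > 0" if z: "a < z" "f z = 0" "z < x" "x < e" for z x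
  proof -
    have "f z < f x"
    proof (rule DERIV_pos_imp_increasing_open[OF z(3)])
      show "\<exists>D. (f has_real_derivative D) (at u) \<and> D > 0" if "z < u" "u < x" for u
        using that z df[of u] h[of u] cross[of z u] Bpos[of z]
        by (intro exI[of _ "h u * B u"]) auto
    qed (use cont z in auto)
    then show ?thesis using z by simp
  qed
  define u where "u = (a + min d y) / 2"
  have u: "a < u" "u < d" "u < y" using neg pos by (auto simp: u_def min_def)
  then obtain z where z: "u \<le> z" "z \<le> y" "f z = 0"
    using IVT'[of f u 0 y] neg(3)[of u] pos cont[of u y] by auto
  show thesis
  proof (rule that[of z])
    show "a < z" "z < e" "f z = 0" using z u pos by auto
    then show "B z > 0" by (intro Bpos)
    show "x = z" if "a < x" "x < e" "f x = 0" for x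
      using later[of x z] later[of z x] that \<open>a < z\<close> \<open>z < e\<close> z(3) by (cases x z rule: linorder_cases) auto
  qed
qed

lemma zeros_counting_multiplicity_eq_1:
  assumes "z \<in> S" "f z = 0" "(f has_real_derivative d) (at z)" "d \<noteq> 0"
    and "\<And>x. x \<in> S \<Longrightarrow> f x = 0 \<Longrightarrow> x = z"
  shows "zeros_counting_multiplicity f S = 1"
proof -
  have 1: "(deriv ^^ 1) f z \<noteq> 0" using assms(3,4) by (simp add: DERIV_imp_deriv)
  have "(LEAST n. (deriv ^^ n) f z \<noteq> 0) = 1"
  proof (rule Least_equality)
    show "(deriv ^^ 1) f z \<noteq> 0" by (fact 1)
    show "1 \<le> n" if "(deriv ^^ n) f z \<noteq> 0" for n
      using that assms(2) by (cases n) auto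
  qed
  moreover have "\<exists>n. (deriv ^^ n) f z \<noteq> 0" using 1 by blast
  ultimately have "zero_multiplicity f z = 1"
    by (simp add: zero_multiplicity_def one_enat_def)
  moreover have "{x \<in> S. f x = 0} = {z}" using assms(1,2,5) by blast
  ultimately show ?thesis by (simp add: zeros_counting_multiplicity_def)
qed

section \<open>The return relation determined by the potential\<close>

text \<open>The half-map enters only through \<open>\<rho>\<close> and \<open>m\<close>, the sliding
  field only through its numerator \<open>L\<close>; its constant positive denominator is later
  absorbed into a factor \<open>k\<close>.\<close>

locale slow_divergence =
  fixes \<rho> m \<Delta> C :: real
  assumes m: "m > 0" and \<Delta>: "\<Delta> > 0"
begin

abbreviation "V \<equiv> spiral_potential \<rho> m"

definition "L u = \<Delta> + C * u"

definition "w u = m\<^sup>2 + (\<rho> * m + u)\<^sup>2"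

definition "R x p \<longleftrightarrow> 0 \<le> x \<and> p \<le> 0 \<and> V p = V x + 2 * pi * \<rho>"

definition "P x = (THE p. R x p)"

definition "J = {x. (\<exists>p. R x p) \<and> (\<forall>u\<in>{P x..x}. L u \<noteq> 0)}"

definition "I x = integral {P x..x} (\<lambda>u. u / L u)"

text \<open>An antiderivative of \<open>u / L u\<close>, meaningful only where \<open>L\<close> is positive.\<close>
definition "Q u = (if C = 0 then u\<^sup>2 / (2 * \<Delta>) else u / C - \<Delta> / C\<^sup>2 * ln (L u))"

lemma V_derivative: "(V has_real_derivative x / w x) (at x)"
  using spiral_potential_has_derivative[of m] m by (simp add: w_def)

lemma w_pos: "w x > 0"
  using spiral_potential_denominator_pos[of m] m by (simp add: w_def)

lemma isCont_V: "isCont V x"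
  using V_derivative by (rule DERIV_isCont)

lemma V_less: "0 \<le> x \<Longrightarrow> x < y \<Longrightarrow> V x < V y" "y \<le> 0 \<Longrightarrow> x < y \<Longrightarrow> V y < V x"
  using spiral_potential_strict_mono spiral_potential_strict_antimono m by auto

lemma V_less_iff:
  "0 \<le> x \<Longrightarrow> 0 \<le> y \<Longrightarrow> V x < V y \<longleftrightarrow> x < y"
  "x \<le> 0 \<Longrightarrow> y \<le> 0 \<Longrightarrow> V x < V y \<longleftrightarrow> y < x"
  using V_less by (smt (verit))+

lemma V_ge_0: "V 0 \<le> V x"
  using V_less[of 0 x] V_less[of x 0] by (cases "x = 0"; cases "x < 0") auto

lemma V_unbounded: "\<exists>u\<ge>0. N \<le> V u" "\<exists>u\<le>0. N \<le> V u"
proof -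
  \<comment> \<open>The exponential makes \<open>ln q\<close> outweigh the arctangent term, which is
    at most \<open>\<bar>\<rho>\<bar> * (pi / 2)\<close>. The summand
    \<open>\<bar>\<rho>\<bar>\<close> gives the witnesses \<open>m * (q - \<rho>)\<close> and
    \<open>m * (- q - \<rho>)\<close> the required signs.\<close>
  define q where "q = exp (N + \<bar>\<rho>\<bar> * (pi / 2)) + \<bar>\<rho>\<bar>"
  have ge: "N \<le> V u" if u: "\<bar>\<rho> + u / m\<bar> = q" for u
  proof -
    have "q > 0" by (simp add: q_def add_pos_nonneg)
    have "exp (N + \<bar>\<rho>\<bar> * (pi / 2)) \<le> q" by (simp add: q_def)
    then have "N + \<bar>\<rho>\<bar> * (pi / 2) \<le> ln q"
      using \<open>q > 0\<close> by (simp add: ln_ge_iff)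
    also have "ln q = ln (q\<^sup>2) / 2" using \<open>q > 0\<close> by (simp add: ln_realpow)
    also have "\<dots> \<le> ln (1 + q\<^sup>2) / 2" using \<open>q > 0\<close> by (simp add: add_pos_pos)
    also have "q\<^sup>2 = (\<rho> + u / m)\<^sup>2" using u by (metis power2_abs)
    finally have "N + \<bar>\<rho>\<bar> * (pi / 2) \<le> ln (1 + (\<rho> + u / m)\<^sup>2) / 2" .
    moreover have "\<rho> * arctan (\<rho> + u / m) \<le> \<bar>\<rho>\<bar> * (pi / 2)"
    proof -
      have "\<bar>arctan (\<rho> + u / m)\<bar> \<le> pi / 2"
        using arctan_bounded[of "\<rho> + u / m"] by linarith
      then have "\<bar>\<rho> * arctan (\<rho> + u / m)\<bar> \<le> \<bar>\<rho>\<bar> * (pi / 2)"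
        unfolding abs_mult by (rule mult_left_mono) simp
      then show ?thesis by linarith
    qed
    ultimately show ?thesis by (simp add: spiral_potential_def)
  qed
  have q: "q \<ge> \<bar>\<rho>\<bar>" by (simp add: q_def)
  have "0 \<le> m * (q - \<rho>)" "m * (- q - \<rho>) \<le> 0"
    using m q by (auto simp: zero_le_mult_iff mult_le_0_iff)
  moreover have "\<bar>\<rho> + (m * (q - \<rho>)) / m\<bar> = q" "\<bar>\<rho> + (m * (- q - \<rho>)) / m\<bar> = q"
    using m q by auto
  ultimately show "\<exists>u\<ge>0. N \<le> V u" "\<exists>u\<le>0. N \<le> V u"
    using ge by blast+
qed

lemma V_surj:
  assumes "V 0 \<le> v"
  shows "\<exists>u\<ge>0. V u = v" "\<exists>u\<le>0. V u = v"
proof -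
  have cont: "continuous_on S V" for S
    using isCont_V by (simp add: continuous_at_imp_continuous_on)
  obtain u where "u \<ge> 0" "v \<le> V u" using V_unbounded by blast
  then show "\<exists>u\<ge>0. V u = v" using IVT'[of V 0 v u] assms cont by auto
  obtain u where "u \<le> 0" "v \<le> V u" using V_unbounded by blast
  then show "\<exists>u\<le>0. V u = v" using IVT2'[of V 0 v u] assms cont by auto
qed

lemma R_less: "R x p \<Longrightarrow> R y r \<Longrightarrow> x < y \<longleftrightarrow> r < p"
  using V_less_iff(1)[of x y] V_less_iff(2)[of p r] by (simp add: R_def)

lemma R_unique: "R x p \<Longrightarrow> R x r \<Longrightarrow> p = r"
  using R_less[of x p x r] R_less[of x r x p] by linarith

lemma P_eq: "R x p \<Longrightarrow> P x = p"
  unfolding P_def using R_unique by blast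

text \<open>A value has a preimage under V on either side of 0 as soon as it is at least the minimum
  \<open>V 0\<close>. For \<open>\<rho> \<ge> 0\<close> the shift is upwards and every x returns;
  for \<open>\<rho> < 0\<close> small x fail, so that case starts from the return point p.\<close>

lemma R_exists_right: "\<rho> \<ge> 0 \<Longrightarrow> 0 \<le> x \<Longrightarrow> \<exists>p. R x p"
proof -
  assume "\<rho> \<ge> 0" "0 \<le> x"
  then have "V 0 \<le> V x + 2 * pi * \<rho>" using V_ge_0[of x] by (simp add: add_increasing2)
  then show ?thesis using V_surj(2) \<open>0 \<le> x\<close> unfolding R_def by blast
qed

lemma R_exists_left: "\<rho> \<le> 0 \<Longrightarrow> p \<le> 0 \<Longrightarrow> \<exists>x. R x p"
proof -
  assume "\<rho> \<le> 0" "p \<le> 0"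
  then have "2 * pi * \<rho> \<le> 0" by (simp add: mult_nonneg_nonpos)
  then have "V 0 \<le> V p - 2 * pi * \<rho>" using V_ge_0[of p] by linarith
  then obtain x where "x \<ge> 0" "V x = V p - 2 * pi * \<rho>" using V_surj(1) by blast
  then show ?thesis using \<open>p \<le> 0\<close> unfolding R_def by (intro exI[of _ x]) linarith
qed

lemma R_exists_above:
  assumes "R x p" "x \<le> y"
  shows "\<exists>r. R y r"
proof -
  have "V p \<le> V y + 2 * pi * \<rho>"
    using assms V_less_iff(1)[of y x] by (force simp: R_def)
  then show ?thesis
    using V_surj(2)[of "V y + 2 * pi * \<rho>"] V_ge_0[of p] assms by (auto simp: R_def)
qed

text \<open>The logarithmic part is no larger at -t than at t, and the arctangent part contributes
  at most \<open>pi * \<bar>\<rho>\<bar>\<close>, half of the shift in \<open>R\<close>.\<close>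

lemma V_reflect: "\<rho> * t \<ge> 0 \<Longrightarrow> V (- t) - V t \<le> pi * \<bar>\<rho>\<bar>"
proof -
  assume t: "\<rho> * t \<ge> 0"
  let ?q = "\<rho> + t / m" and ?r = "\<rho> + - t / m"
  have "?q\<^sup>2 - ?r\<^sup>2 = 4 * (\<rho> * t / m)" by (simp add: power2_eq_square algebra_simps)
  moreover have "\<rho> * t / m \<ge> 0" using t m by simp
  ultimately have "ln (1 + ?r\<^sup>2) \<le> ln (1 + ?q\<^sup>2)"
    by (intro ln_mono) (auto simp: add_pos_nonneg)
  moreover have "\<rho> * (arctan ?q - arctan ?r) \<le> pi * \<bar>\<rho>\<bar>"
  proof -
    have "\<bar>arctan ?q - arctan ?r\<bar> \<le> pi"
      using arctan_bounded[of ?q] arctan_bounded[of ?r] by linarith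
    then have "\<bar>\<rho> * (arctan ?q - arctan ?r)\<bar> \<le> \<bar>\<rho>\<bar> * pi"
      unfolding abs_mult by (rule mult_left_mono) simp
    then show ?thesis by (simp add: mult.commute)
  qed
  ultimately show ?thesis
    by (simp add: spiral_potential_def algebra_simps)
qed

lemma R_asymmetric:
  assumes R: "R x p"
  shows "\<rho> > 0 \<Longrightarrow> p < - x" "\<rho> < 0 \<Longrightarrow> - p < x" "\<rho> = 0 \<Longrightarrow> p = - x"
proof -
  assume \<rho>: "\<rho> > 0"
  then have "V (- x) - V x \<le> pi * \<rho>" "0 < pi * \<rho>"
    using V_reflect[of x] R by (simp_all add: R_def)
  then have "V (- x) < V p"
    using R unfolding R_def by linarith
  then show "p < - x" using V_less_iff(2)[of "- x" p] R by (simp add: R_def)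
next
  assume \<rho>: "\<rho> < 0"
  then have "V (- p) - V p \<le> - (pi * \<rho>)" "pi * \<rho> < 0"
    using V_reflect[of p] R by (simp_all add: R_def mult_nonpos_nonpos mult_pos_neg)
  then have "V (- p) < V x"
    using R unfolding R_def by linarith
  then show "- p < x" using V_less_iff(1)[of "- p" x] R by (simp add: R_def)
next
  assume \<rho>: "\<rho> = 0"
  have "V (- x) = V x" unfolding spiral_potential_def \<rho> by simp
  then have "V (- x) = V p" using R[unfolded R_def] \<rho> by simp
  then show "p = - x" using V_less_iff(2)[of "- x" p] V_less_iff(2)[of p "- x"] R by (simp add: R_def)
qed

text \<open>\<open>P\<close> is V, a shift, and then the inverse \<open>g\<close> of V on the
  nonpositive numbers. As V' vanishes at 0, \<open>g\<close> is differentiable only away from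
  \<open>V 0\<close>; hence the strict \<open>r < 0\<close>.\<close>

lemma P_derivative:
  assumes "a < x" "x < e" and S: "\<And>y. a < y \<Longrightarrow> y < e \<Longrightarrow> \<exists>r<0. R y r"
  shows "(P has_real_derivative (x * w (P x)) / (P x * w x)) (at x)"
proof -
  obtain p where p: "p < 0" "R x p" using S[OF assms(1,2)] by blast
  define g where "g v = (THE u. u \<le> 0 \<and> V u = v)" for v
  have inj: "u = u'" if "u \<le> 0" "u' \<le> 0" "V u = V u'" for u u'
    using V_less_iff(2)[of u u'] V_less_iff(2)[of u' u] that by simp
  have gV: "g (V u) = u" if "u \<le> 0" for u
    unfolding g_def using that inj by (intro the_equality) auto
  have Vg: "V (g v) = v" if "V 0 \<le> v" for v
    using V_surj(2)[OF that] gV by force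
  \<comment> \<open>The radius -p keeps the neighbourhood of p inside the nonpositive numbers, where
    \<open>g\<close> inverts V.\<close>
  have "isCont g (V p)"
    using p gV isCont_V by (intro isCont_inverse_function[of "- p" p g V]) auto
  then have "(g has_real_derivative inverse (p / w p)) (at (V p))"
    using V_derivative[of p] w_pos[of p] p V_less_iff(2)[of 0 p] Vg gV[of p]
    by (intro DERIV_inverse_function[where f = V and a = "V 0" and b = "V p + 1"]) auto
  moreover have "((\<lambda>y. V y + 2 * pi * \<rho>) has_real_derivative x / w x) (at x)"
    using V_derivative[of x] by (auto intro!: derivative_eq_intros)
  ultimately have "((\<lambda>y. g (V y + 2 * pi * \<rho>)) has_real_derivative
      inverse (p / w p) * (x / w x)) (at x)"
    using p by (intro DERIV_chain2[where f = g]) (simp_all add: R_def)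
  then have "(P has_real_derivative inverse (p / w p) * (x / w x)) (at x)"
  proof (rule has_field_derivative_transform_within_open)
    show "open {a<..<e}" "x \<in> {a<..<e}" using assms by auto
    fix y assume "y \<in> {a<..<e}"
    then obtain r where r: "r < 0" "R y r" using S[of y] by auto
    then have "V r = V y + 2 * pi * \<rho>" by (simp add: R_def)
    then show "g (V y + 2 * pi * \<rho>) = P y"
      using gV[of r] r P_eq[OF r(2)] by simp
  qed
  then show ?thesis using P_eq[OF p(2)] by (simp add: field_simps)
qed

section \<open>The antiderivative of the integrand\<close>

lemma L_between: "L a > 0 \<Longrightarrow> L b > 0 \<Longrightarrow> a \<le> u \<Longrightarrow> u \<le> b \<Longrightarrow> L u > 0"
  unfolding L_def
  by (cases "C \<ge> 0") (smt (verit) mult_left_mono, smt (verit) mult_left_mono_neg)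

lemma L_0: "L 0 > 0"
  using \<Delta> by (simp add: L_def)

lemma Q_derivative: "L u > 0 \<Longrightarrow> (Q has_real_derivative u / L u) (at u)"
proof (cases "C = 0")
  case True
  then show ?thesis
    unfolding Q_def[abs_def] L_def using \<Delta> by (auto intro!: derivative_eq_intros simp: field_simps)
next
  case False
  assume L: "L u > 0"
  have dL: "(L has_real_derivative C) (at u)"
    unfolding L_def[abs_def] by (auto intro!: derivative_eq_intros)
  have "((\<lambda>u. u / C - \<Delta> / C\<^sup>2 * ln (L u)) has_real_derivative
      1 / C - \<Delta> / C\<^sup>2 * (C / L u)) (at u)"
    using False L by (auto intro!: derivative_eq_intros dL simp: field_simps power2_eq_square power4_eq_xxxx)
  moreover have "1 / C - \<Delta> / C\<^sup>2 * (C / L u) = u / L u"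
  proof -
    have "1 / C = L u / (C * L u)" "\<Delta> / C\<^sup>2 * (C / L u) = \<Delta> / (C * L u)"
      using False L by (simp_all add: power2_eq_square)
    then have "1 / C - \<Delta> / C\<^sup>2 * (C / L u) = (L u - \<Delta>) / (C * L u)"
      by (simp only: diff_divide_distrib)
    then show ?thesis using False by (simp add: L_def)
  qed
  ultimately show ?thesis
    using False unfolding Q_def[abs_def] by simp
qed

lemma Q_continuous_on: "(\<And>u. u \<in> S \<Longrightarrow> L u > 0) \<Longrightarrow> continuous_on S Q"
  using Q_derivative by (intro continuous_at_imp_continuous_on) (auto intro: DERIV_isCont)

lemma Q_strict_mono:
  assumes "0 \<le> x" "x < y" "L x > 0" "L y > 0"
  shows "Q x < Q y"
proof (rule DERIV_pos_imp_increasing_open[OF assms(2)])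
  show "\<exists>d. (Q has_real_derivative d) (at u) \<and> d > 0" if "x < u" "u < y" for u
    using Q_derivative[of u] L_between[of x y u] that assms by (intro exI[of _ "u / L u"]) auto
  show "continuous_on {x..y} Q"
    using L_between[of x y] assms by (intro Q_continuous_on) auto
qed

lemma Q_strict_antimono:
  assumes "y \<le> 0" "x < y" "L x > 0" "L y > 0"
  shows "Q y < Q x"
proof (rule DERIV_neg_imp_decreasing_open[OF assms(2)])
  show "\<exists>d. (Q has_real_derivative d) (at u) \<and> d < 0" if "x < u" "u < y" for u
    using Q_derivative[of u] L_between[of x y u] that assms
    by (intro exI[of _ "u / L u"]) (auto simp: divide_neg_pos)
  show "continuous_on {x..y} Q"
    using L_between[of x y] assms by (intro Q_continuous_on) auto
qed

text \<open>\<open>Q t - Q (- t)\<close> is the integral over [-t, t]. Folding it at 0 leaves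
  \<open>u / L u - u / L (- u)\<close>, whose sign for u > 0 is opposite to that of C.\<close>

lemma Q_reflect:
  assumes t: "0 < t" "L t > 0" "L (- t) > 0"
  shows "C > 0 \<Longrightarrow> Q t < Q (- t)" "C < 0 \<Longrightarrow> Q (- t) < Q t" "C = 0 \<Longrightarrow> Q (- t) = Q t"
proof -
  have d: "((\<lambda>u. Q (- u) - Q u) has_real_derivative u / L (- u) - u / L u) (at u)"
    if "L u > 0" "L (- u) > 0" for u
    using DERIV_diff[OF DERIV_mirror[THEN iffD1, OF Q_derivative[OF that(2)]] Q_derivative[OF that(1)]]
    by simp
  have L: "L u > 0" "L (- u) > 0" if "0 \<le> u" "u \<le> t" for u
    using L_between[of "- t" t] t that by auto
  have cont: "continuous_on {0..t} (\<lambda>u. Q (- u) - Q u)"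
    using d L by (intro DERIV_continuous_on[where D = "\<lambda>u. u / L (- u) - u / L u"])
      (auto intro: has_field_derivative_at_within)
  show "Q t < Q (- t)" if "C > 0"
  proof -
    have "Q (- 0) - Q 0 < Q (- t) - Q t"
    proof (rule DERIV_pos_imp_increasing_open[OF t(1)])
      fix u assume u: "0 < u" "u < t"
      have "L (- u) < L u" using that u by (simp add: L_def)
      then have "u / L (- u) - u / L u > 0" using L[of u] u by (simp add: frac_less2)
      then show "\<exists>y. ((\<lambda>u. Q (- u) - Q u) has_real_derivative y) (at u) \<and> 0 < y"
        using d[of u] L[of u] u by auto
    qed (rule cont)
    then show ?thesis by simp
  qed
  show "Q (- t) < Q t" if "C < 0"
  proof -
    have "Q (- t) - Q t < Q (- 0) - Q 0"
    proof (rule DERIV_neg_imp_decreasing_open[OF t(1)])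
      fix u assume u: "0 < u" "u < t"
      have "L u < L (- u)" using that u by (simp add: L_def mult_neg_pos)
      then have "u / L (- u) - u / L u < 0" using L[of u] u by (simp add: frac_less2)
      then show "\<exists>y. ((\<lambda>u. Q (- u) - Q u) has_real_derivative y) (at u) \<and> y < 0"
        using d[of u] L[of u] u by auto
    qed (rule cont)
    then show ?thesis by simp
  qed
  show "Q (- t) = Q t" if "C = 0"
    unfolding Q_def using that by simp
qed

text \<open>The term \<open>- \<Delta> / C\<^sup>2 * ln (L u)\<close> tends to plus infinity at the
  zero of \<open>L\<close> for either sign of C. Likewise \<open>L u < L u0\<close> says for either
  sign that u is closer to that zero than u0.\<close>

lemma Q_unbounded:
  assumes "C \<noteq> 0" "0 < L u0"
  shows "\<exists>u. 0 < L u \<and> L u < L u0 \<and> N < Q u"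
proof -
  define N' where "N' = \<bar>N\<bar> + \<Delta> / C\<^sup>2"
  \<comment> \<open>The prescribed value of \<open>L u\<close>. The exponent makes the logarithmic
    term at least \<open>N' + 1\<close>, and \<open>N'\<close> includes the possible loss
    \<open>\<Delta> / C\<^sup>2\<close> from \<open>u / C\<close>.\<close>
  define d where "d = min (L u0 / 2) (exp (- (N' + 1) * C\<^sup>2 / \<Delta>))"
  have d: "d > 0" "d < L u0" "d \<le> exp (- (N' + 1) * C\<^sup>2 / \<Delta>)"
    using assms by (auto simp: d_def min_def)
  define u where "u = (d - \<Delta>) / C"
  have u: "L u = d" using assms by (simp add: u_def L_def)
  have "ln d \<le> - (N' + 1) * C\<^sup>2 / \<Delta>"
    using d by (metis exp_gt_zero ln_exp ln_le_cancel_iff)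
  then have "N' + 1 \<le> - (\<Delta> / C\<^sup>2 * ln d)"
    using \<Delta> assms by (simp add: field_simps)
  moreover have "u / C = d / C\<^sup>2 - \<Delta> / C\<^sup>2"
    using assms by (simp add: u_def power2_eq_square diff_divide_distrib)
  moreover have "d / C\<^sup>2 \<ge> 0" using d by simp
  ultimately have "N < Q u"
    using assms unfolding Q_def u N'_def by simp
  then show ?thesis using u d by blast
qed

text \<open>\<open>L\<close> is affine with \<open>L 0 > 0\<close>, and 0 lies in
  \<open>{p..x}\<close>; so having no zero there means being positive at both ends.\<close>

lemma J_iff: "x \<in> J \<longleftrightarrow> (\<exists>p. R x p \<and> L x > 0 \<and> L p > 0)"
proof
  assume "x \<in> J"
  then obtain p where p: "R x p" and nz: "\<And>u. p \<le> u \<Longrightarrow> u \<le> x \<Longrightarrow> L u \<noteq> 0"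
    using P_eq by (auto simp: J_def)
  have px: "p \<le> 0" "0 \<le> x" using p by (auto simp: R_def)
  have contL: "continuous_on S L" for S
    unfolding L_def[abs_def] by (intro continuous_intros)
  have "L x > 0"
    using IVT2'[of L x 0 0, OF _ _ _ contL] L_0 px nz by (smt (verit))
  moreover have "L p > 0"
    using IVT'[of L p 0 0, OF _ _ _ contL] L_0 px nz by (smt (verit))
  ultimately show "\<exists>p. R x p \<and> L x > 0 \<and> L p > 0" using p by blast
next
  assume "\<exists>p. R x p \<and> L x > 0 \<and> L p > 0"
  then obtain p where p: "R x p" "L x > 0" "L p > 0" by blast
  then have "L u \<noteq> 0" if "u \<in> {p..x}" for u
    using L_between[of p x u] that by auto
  then show "x \<in> J" unfolding J_def using p P_eq[OF p(1)] by auto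
qed

lemma I_eq:
  assumes "R x p" "L x > 0" "L p > 0"
  shows "I x = Q x - Q p"
proof -
  have "((\<lambda>u. u / L u) has_integral (Q x - Q p)) {p..x}"
  proof (rule fundamental_theorem_of_calculus)
    show "p \<le> x" using assms by (simp add: R_def)
    show "(Q has_vector_derivative u / L u) (at u within {p..x})" if "u \<in> {p..x}" for u
      using Q_derivative[of u] L_between[of p x u] that assms
      by (auto simp: has_real_derivative_iff_has_vector_derivative
          intro: has_vector_derivative_at_within)
  qed
  then show ?thesis using P_eq[OF assms(1)] by (simp add: I_def integral_unique)
qed

section \<open>The derivative of the integral and the factor that decides its sign\<close>

text \<open>The antisymmetric polynomial in \<open>w_L_cross\<close> vanishes at p = x; this is its
  quotient by x - p, taken at p = \<open>P x\<close>. The last two terms come from the linear and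
  constant coefficients of \<open>w\<close>.\<close>

definition "B x = \<Delta> * (x + P x) + C * x * P x + 2 * \<rho> * m * \<Delta> - (1 + \<rho>\<^sup>2) * m\<^sup>2 * C"

lemma w_L_cross: "w x * L p - w p * L x =
    (x - p) * (\<Delta> * (x + p) + C * x * p + 2 * \<rho> * m * \<Delta> - (1 + \<rho>\<^sup>2) * m\<^sup>2 * C)"
  unfolding w_def L_def by algebra

lemma I_derivative:
  assumes x: "a < x" "x < e"
    and S: "\<And>y. a < y \<Longrightarrow> y < e \<Longrightarrow> \<exists>r<0. R y r \<and> L y > 0 \<and> L r > 0"
  shows "(I has_real_derivative
    x * (x - P x) / (w x * L x * L (P x)) * B x) (at x)"
proof -
  obtain p where p: "p < 0" "R x p" "L x > 0" "L p > 0" using S[OF x] by blast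
  have Px: "P x = p" using P_eq p by simp
  have dP: "(P has_real_derivative (x * w p) / (p * w x)) (at x)"
    using P_derivative[OF x] S unfolding Px by blast
  have "((\<lambda>y. Q (P y)) has_real_derivative p / L p * ((x * w p) / (p * w x))) (at x)"
    using Q_derivative[OF p(4)] dP Px by (intro DERIV_chain2[where f = Q]) auto
  then have "((\<lambda>y. Q y - Q (P y)) has_real_derivative
      x / L x - p / L p * ((x * w p) / (p * w x))) (at x)"
    by (intro DERIV_diff Q_derivative p)
  then have "(I has_real_derivative x / L x - p / L p * ((x * w p) / (p * w x))) (at x)"
  proof (rule has_field_derivative_transform_within_open)
    show "open {a<..<e}" "x \<in> {a<..<e}" using x by auto
    show "Q y - Q (P y) = I y" if "y \<in> {a<..<e}" for y
      using S[of y] that I_eq[of y] P_eq[of y] by force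
  qed
  moreover have "x / L x - p / L p * ((x * w p) / (p * w x)) =
      x * (w x * L p - w p * L x) / (w x * L x * L p)"
    using p w_pos[of x] by (simp add: field_simps)
  ultimately show ?thesis
    unfolding w_L_cross Px B_def by (simp add: mult.assoc)
qed

text \<open>The partial derivatives of the polynomial in x and p are \<open>L p\<close> and
  \<open>L x\<close>, so B' is \<open>L p + L x\<close> P'. At a zero of \<open>B\<close>,
  \<open>w x * L p = w p * L x\<close> removes \<open>w\<close> from P', which leaves
  \<open>L p * (1 + x / p)\<close>.\<close>

lemma B_derivative:
  assumes x: "a < x" "x < e" and S: "\<And>y. a < y \<Longrightarrow> y < e \<Longrightarrow> \<exists>r<0. R y r \<and> L y > 0 \<and> L r > 0"
  shows "(B has_real_derivative L (P x) + L x * (x * w (P x) / (P x * w x))) (at x)"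
    and "B x = 0 \<Longrightarrow> L (P x) + L x * (x * w (P x) / (P x * w x)) = L (P x) * (x + P x) / P x"
proof -
  obtain p where p: "p < 0" "R x p" "L x > 0" "L p > 0" using S[OF x] by blast
  have Px: "P x = p" using P_eq p by simp
  define D where "D = x * w (P x) / (P x * w x)"
  have dP: "(P has_real_derivative D) (at x)"
    unfolding D_def by (rule P_derivative[OF x]) (use S in blast)
  show "(B has_real_derivative L (P x) + L x * (x * w (P x) / (P x * w x))) (at x)"
    unfolding B_def[abs_def] D_def[symmetric]
    by (rule derivative_eq_intros dP refl)+ (simp add: L_def algebra_simps)
  assume "B x = 0"
  then have eq: "w x * L p = w p * L x"
    using w_L_cross[of x p] unfolding B_def Px by simp
  have "L x * (x * w p / (p * w x)) = (w p * L x) * x / (p * w x)"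
    by simp
  also have "\<dots> = (w x * L p) * x / (p * w x)"
    by (simp only: eq)
  also have "\<dots> = L p * x / p"
    using w_pos[of x] by simp
  finally show "L (P x) + L x * (x * w (P x) / (P x * w x)) = L (P x) * (x + P x) / P x"
    unfolding Px using p by (simp add: field_simps)
qed

text \<open>The sign \<open>\<epsilon>\<close> turns every sign change of \<open>B\<close> into an upcrossing.\<close>
lemma count_eq_1:
  assumes k: "k > 0" and \<epsilon>: "\<epsilon> = sgn \<rho>" "\<rho> \<noteq> 0"
    and S: "\<And>x. a < x \<Longrightarrow> x < e \<Longrightarrow> 0 < x \<and> (\<exists>p<0. R x p \<and> L x > 0 \<and> L p > 0)"
    and int: "interior J = {a<..<e}"
    and neg: "a < d" "d < e" "\<And>x. a < x \<Longrightarrow> x < d \<Longrightarrow> \<epsilon> * I x < 0"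
    and pos: "a < y" "y < e" "\<epsilon> * I y > 0"
  shows "zeros_counting_multiplicity (\<lambda>x. k * I x) (interior J) = 1"
proof -
  define h where "h x = x * (x - P x) / (w x * L x * L (P x))" for x
  define B' where "B' x = L (P x) + L x * (x * w (P x) / (P x * w x))" for x
  have S': "\<exists>p<0. R x p \<and> L x > 0 \<and> L p > 0" if "a < x" "x < e" for x
    using S that by blast
  have dI: "(I has_real_derivative h x * B x) (at x)" if "a < x" "x < e" for x
    using I_derivative[OF that S'] by (simp add: h_def)
  have h: "h x > 0" if x: "a < x" "x < e" for x
    using S[OF x] w_pos[of x] P_eq[of x] by (auto simp: h_def intro!: divide_pos_pos mult_pos_pos)
  obtain z where z: "a < z" "z < e" "\<epsilon> * I z = 0" "\<epsilon> * B z > 0"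
    "\<And>x. a < x \<Longrightarrow> x < e \<Longrightarrow> \<epsilon> * I x = 0 \<Longrightarrow> x = z"
  proof (rule unique_simple_zero_of_upcrossing_derivative
      [of a e "\<lambda>x. \<epsilon> * I x" h "\<lambda>x. \<epsilon> * B x" "\<lambda>x. \<epsilon> * B' x" d y])
    fix x assume x: "a < x" "x < e"
    show "((\<lambda>x. \<epsilon> * I x) has_real_derivative h x * (\<epsilon> * B x)) (at x)"
      using DERIV_cmult[OF dI[OF x], of \<epsilon>] by (simp add: mult_ac)
    show "h x > 0" using h x .
    show "((\<lambda>x. \<epsilon> * B x) has_real_derivative \<epsilon> * B' x) (at x)"
      unfolding B'_def by (intro DERIV_cmult B_derivative(1)[OF x S'])
    assume "\<epsilon> * B x = 0"
    then have "B' x = L (P x) * (x + P x) / P x"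
      using B_derivative(2)[OF x S'] \<epsilon> by (simp add: B'_def sgn_zero_iff)
    moreover obtain p where p: "p < 0" "R x p" "L p > 0" using S'[OF x] by blast
    moreover have "P x = p" using P_eq p by simp
    moreover have "\<epsilon> * (x + p) < 0"
      using R_asymmetric(1,2)[OF p(2)] \<epsilon> by (cases "\<rho> > 0") auto
    then have "L p * (\<epsilon> * (x + p)) / p > 0"
      using p(1) by (rule divide_neg_neg[OF mult_pos_neg[OF p(3)]])
    ultimately show "\<epsilon> * B' x > 0" by (simp add: mult_ac)
  next
    show "a < d" "d < e" by (fact neg)+
    show "\<epsilon> * I x < 0" if "a < x" "x < d" for x
      using that by (rule neg)
    show "a < y" "y < e" "\<epsilon> * I y > 0"
      using pos by blast+
  next
    fix z assume "a < z" "z < e" "\<epsilon> * I z = 0" "\<epsilon> * B z > 0"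
      "\<And>x. a < x \<Longrightarrow> x < e \<Longrightarrow> \<epsilon> * I x = 0 \<Longrightarrow> x = z"
    then show thesis by (rule that)
  qed
  show ?thesis
  proof (rule zeros_counting_multiplicity_eq_1[of z])
    show "z \<in> interior J" using int z(1,2) by simp
    show "k * I z = 0" using z(3) \<epsilon> by (simp add: sgn_zero_iff)
    show "((\<lambda>x. k * I x) has_real_derivative k * (h z * B z)) (at z)"
      by (intro DERIV_cmult dI z(1,2))
    show "k * (h z * B z) \<noteq> 0" using k h[of z] z(1,2,4) by auto
    show "x = z" if "x \<in> interior J" "k * I x = 0" for x
      using that k int by (intro z(5)) auto
  qed
qed

section \<open>Signs at the two ends of the domain, and the zero count\<close>

text \<open>Near x = 0 the integral is close to that over \<open>{p0..0}\<close>, where u is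
  negative. Near the zero \<open>e\<close> of \<open>L\<close>, \<open>Q x\<close> is unbounded
  while \<open>Q (P x)\<close> stays below \<open>Q pe\<close>.\<close>

lemma count_eq_1_unstable:
  assumes k: "k > 0" and \<rho>: "\<rho> > 0" and C: "C < 0"
  shows "zeros_counting_multiplicity (\<lambda>x. k * I x) (interior J) = 1"
proof -
  define e where "e = - \<Delta> / C"
  have e: "e > 0" using \<Delta> C by (simp add: e_def divide_pos_neg)
  have L: "L x > 0 \<longleftrightarrow> x < e" for x
    using C by (auto simp: L_def e_def field_simps)
  have J: "J = {0..<e}"
  proof (intro set_eqI iffI)
    show "x \<in> {0..<e}" if "x \<in> J" for x
      using that L by (auto simp: J_iff R_def)
    fix x assume x: "x \<in> {0..<e}"
    then obtain p where p: "R x p" using R_exists_right[of x] \<rho> by auto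
    moreover have "L p > 0" using p L e by (simp add: R_def)
    ultimately show "x \<in> J" using x L by (auto simp: J_iff)
  qed
  have neg: "R x p \<Longrightarrow> p < 0" for x p
    using R_asymmetric(1)[of x p] \<rho> by (simp add: R_def)
  obtain p0 where p0: "R 0 p0" using R_exists_right[of 0] \<rho> by auto
  \<comment> \<open>\<open>R\<close> does not involve \<open>L\<close>, so the return point of
    \<open>e\<close> exists although \<open>e\<close> is outside \<open>J\<close>.\<close>
  obtain pe where pe: "R e pe" using R_exists_right[of e] \<rho> e by auto
  have p0': "p0 < 0" "L p0 > 0" using neg[OF p0] L[of p0] e by simp_all
  have pe': "pe < 0" "L pe > 0" using neg[OF pe] L[of pe] e by simp_all
  have Q0: "Q 0 < Q p0" using Q_strict_antimono[of 0 p0] p0' L_0 by simp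
  have "isCont Q 0" using Q_derivative[OF L_0] by (rule DERIV_isCont)
  then have "eventually (\<lambda>x. Q x < Q p0) (at 0)"
    using Q0 by (simp add: isCont_def order_tendstoD(2))
  then obtain d where d: "d > 0" "\<And>x. x \<noteq> 0 \<Longrightarrow> \<bar>x\<bar> < d \<Longrightarrow> Q x < Q p0"
    by (auto simp: eventually_at dist_real_def)
  obtain y where y: "0 < L y" "L y < L (e / 2)" "Q pe < Q y"
    using Q_unbounded[of "e / 2" "Q pe"] C L e by auto
  have y': "0 < y" "y < e"
  proof -
    have "C * y < C * (e / 2)" using y by (simp add: L_def)
    then have "e / 2 < y" using C by (simp only: mult_less_cancel_left_neg)
    then show "0 < y" using e by simp
    show "y < e" using y L by simp
  qed
  have I: "I x = Q x - Q p" if "R x p" "x < e" for x p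
    using I_eq[of x p] that L[of x] L[of p] e by (auto simp: R_def)
  show ?thesis
  proof (rule count_eq_1[of k 1 0 e "min d (e / 2)" y])
    show "0 < x \<and> (\<exists>p<0. R x p \<and> L x > 0 \<and> L p > 0)" if x: "0 < x" "x < e" for x
    proof -
      obtain p where p: "R x p" using R_exists_right[of x] \<rho> x by auto
      then show ?thesis using x neg[OF p] L[of x] L[of p] e by auto
    qed
    show "interior J = {0<..<e}" by (simp add: J)
    show "1 * I x < 0" if x: "0 < x" "x < min d (e / 2)" for x
    proof -
      obtain p where p: "R x p" using R_exists_right[of x] x \<rho> by auto
      then have "p < p0" using R_less[OF p0] x by simp
      then have "Q p0 < Q p"
        using Q_strict_antimono[of p0 p] p0' L[of p] e neg[OF p] by simp
      then show ?thesis using I[OF p] d(2)[of x] x by simp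
    qed
    show "1 * I y > 0"
    proof -
      obtain p where p: "R y p" using R_exists_right[of y] y' \<rho> by auto
      then have "pe < p" using R_less[OF p pe] y' by simp
      then have "Q p < Q pe"
        using Q_strict_antimono[of p pe] pe' L[of p] e neg[OF p] by simp
      then show ?thesis using I[OF p] y' y by simp
    qed
  qed (use k \<rho> d e y' in auto)
qed

text \<open>The mirror image: the zero \<open>f\<close> of \<open>L\<close> is negative, and the
  domain runs from the preimage \<open>a\<close> of 0 to the preimage \<open>e\<close> of
  \<open>f\<close>. Near \<open>a\<close> only positive u contribute; near \<open>e\<close>,
  \<open>Q (P x)\<close> is unbounded.\<close>

lemma count_eq_1_stable:
  assumes k: "k > 0" and \<rho>: "\<rho> < 0" and C: "C > 0"
  shows "zeros_counting_multiplicity (\<lambda>x. k * I x) (interior J) = 1"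
proof -
  define f where "f = - \<Delta> / C"
  have f: "f < 0" using \<Delta> C by (simp add: f_def)
  have L: "L x > 0 \<longleftrightarrow> f < x" for x
    using C by (auto simp: L_def f_def field_simps)
  obtain a where a: "R a 0" using R_exists_left[of 0] \<rho> by auto
  obtain e where e: "R e f" using R_exists_left[of f] \<rho> f by auto
  have pos: "R x p \<Longrightarrow> 0 < x" for x p
    using R_asymmetric(2)[of x p] \<rho> by (simp add: R_def)
  have "a < e" using R_less[OF a e] f by simp
  have inside: "a < x \<and> x < e \<longleftrightarrow> f < p \<and> p < 0" if "R x p" for x p
    using R_less[OF a that] R_less[OF that e] by auto
  have J: "J = {a..<e}"
  proof (intro set_eqI iffI)
    fix x assume "x \<in> J"
    then obtain p where p: "R x p" "f < p" using L by (auto simp: J_iff)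
    then show "x \<in> {a..<e}"
      using R_less[OF p(1) a] R_less[OF p(1) e] by (auto simp: R_def)
  next
    fix x assume x: "x \<in> {a..<e}"
    then obtain p where p: "R x p" using R_exists_above[OF a] by auto
    then have "f < p" using R_less[OF p e] x by simp
    then show "x \<in> J" using p L pos[OF p] f by (auto simp: J_iff)
  qed
  have Q0: "Q 0 < Q a" using Q_strict_mono[of 0 a] pos[OF a] L f by simp
  have "isCont Q 0" using Q_derivative[OF L_0] by (rule DERIV_isCont)
  then have "eventually (\<lambda>x. Q x < Q a) (at 0)"
    using Q0 by (simp add: isCont_def order_tendstoD(2))
  then obtain b where b: "b > 0" "\<And>x. x \<noteq> 0 \<Longrightarrow> \<bar>x\<bar> < b \<Longrightarrow> Q x < Q a"
    by (auto simp: eventually_at dist_real_def)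
  \<comment> \<open>Between \<open>pd\<close> and 0, \<open>Q\<close> stays below
    \<open>Q a\<close>; the preimage \<open>d\<close> of \<open>pd\<close> then bounds the interval
    on which \<open>I\<close> is shown to be positive.\<close>
  define pd where "pd = - min (b / 2) (- f / 2)"
  have pd: "f < pd" "pd < 0" "- b < pd" using b f by (auto simp: pd_def min_def)
  obtain d where d: "R d pd" using R_exists_left[of pd] \<rho> pd by auto
  \<comment> \<open>\<open>Q e\<close> bounds \<open>Q x\<close> for x between \<open>a\<close> and
    \<open>e\<close>, so \<open>I\<close> is negative at the point returning to
    \<open>r\<close>.\<close>
  obtain r where r: "0 < L r" "L r < L (f / 2)" "Q e < Q r"
    using Q_unbounded[of "f / 2" "Q e"] C L f by auto
  have r': "f < r" "r < 0"
    using r C f L by (auto simp: L_def)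
  obtain y where y: "R y r" using R_exists_left[of r] \<rho> r' by auto
  have I: "I x = Q x - Q p" if "R x p" "f < p" for x p
    using I_eq[of x p] that L[of x] L[of p] f pos[OF that(1)] by auto
  show ?thesis
  proof (rule count_eq_1[of k "-1" a e d y])
    show "0 < x \<and> (\<exists>p<0. R x p \<and> L x > 0 \<and> L p > 0)" if x: "a < x" "x < e" for x
    proof -
      obtain p where p: "R x p" using R_exists_above[OF a, of x] x by auto
      then show ?thesis using inside[OF p] x pos[OF p] L f by auto
    qed
    show "interior J = {a<..<e}" by (simp add: J)
    show "a < d" "d < e" using inside[OF d] pd by auto
    show "a < y" "y < e" using inside[OF y] r' by auto
    show "- 1 * I x < 0" if x: "a < x" "x < d" for x
    proof -
      obtain p where p: "R x p" using R_exists_above[OF a, of x] x by auto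
      then have "pd < p" "p < 0" using R_less[OF p d] R_less[OF a p] x by auto
      then have "Q p < Q a" using b(2)[of p] pd by auto
      moreover have "Q a < Q x"
        using Q_strict_mono[of a x] x pos[OF a] L f by simp
      ultimately show ?thesis using I[OF p] \<open>pd < p\<close> pd by simp
    qed
    show "- 1 * I y > 0"
    proof -
      have "y < e" using inside[OF y] r' by auto
      then have "Q y < Q e" using Q_strict_mono[of y e] pos[OF y] L f by simp
      then show ?thesis using I[OF y] r' r by simp
    qed
  qed (use k \<rho> in auto)
qed

text \<open>The comparison interval must lie inside \<open>{p..x}\<close>, where \<open>L\<close> is
  positive: it is [-x, x] for \<open>\<rho> \<ge> 0\<close> and [p, -p] for
  \<open>\<rho> \<le> 0\<close>. The symmetric part and the remainder then contribute with the same
  sign.\<close>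

lemma I_nonzero:
  assumes x: "x \<in> J" "x > 0"
    and signs: "\<rho> \<ge> 0 \<and> C \<ge> 0 \<or> \<rho> \<le> 0 \<and> C \<le> 0" "\<rho> \<noteq> 0 \<or> C \<noteq> 0"
  shows "I x \<noteq> 0"
proof -
  obtain p where p: "R x p" "L x > 0" "L p > 0" using x by (auto simp: J_iff)
  have p0: "p \<le> 0" using p by (simp add: R_def)
  show ?thesis
  proof (cases "\<rho> \<ge> 0 \<and> C \<ge> 0")
    case True
    have px: "p \<le> - x" using R_asymmetric(1,3)[OF p(1)] True by (cases "\<rho> = 0") auto
    have Lx: "L (- x) > 0" using L_between[of p x "- x"] p px x by auto
    have 1: "Q x \<le> Q (- x)" "C \<noteq> 0 \<Longrightarrow> Q x < Q (- x)"
      using Q_reflect(1,3)[OF x(2) p(2) Lx] True by (cases "C = 0"; simp)+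
    have 2: "Q (- x) \<le> Q p"
      using Q_strict_antimono[of "- x" p] px x Lx p by (cases "p = - x") auto
    have 3: "Q (- x) < Q p" if "\<rho> \<noteq> 0"
      using Q_strict_antimono[of "- x" p] R_asymmetric(1)[OF p(1)] x Lx p True that by auto
    have "Q x < Q p"
      using 1 2 3 signs(2) by linarith
    then show ?thesis using I_eq[OF p] by simp
  next
    case False
    then have s: "\<rho> \<le> 0" "C \<le> 0" using signs by auto
    have px: "- p \<le> x" using R_asymmetric(2,3)[OF p(1)] s by (cases "\<rho> = 0") auto
    have Lp: "L (- p) > 0" using L_between[of p x "- p"] p px p0 x by auto
    have 1: "Q p \<le> Q (- p)"
      using Q_reflect(2,3)[of "- p"] p Lp p0 s by (cases "p = 0"; cases "C = 0") auto
    have 2: "Q (- p) \<le> Q x"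
      using Q_strict_mono[of "- p" x] px p0 Lp p by (cases "x = - p") auto
    have 3: "Q (- p) < Q x" if "\<rho> \<noteq> 0"
      using Q_strict_mono[of "- p" x] R_asymmetric(2)[OF p(1)] p0 Lp p s that by auto
    have 4: "Q p < Q (- p)" if "\<rho> = 0"
      using Q_reflect(2)[of "- p"] R_asymmetric(3)[OF p(1) that] x p Lp s signs(2) that by auto
    have "Q p < Q x"
      using 1 2 3 4 by linarith
    then show ?thesis using I_eq[OF p] by simp
  qed
qed

theorem count_eq_1_iff:
  assumes k: "k > 0"
  shows "zeros_counting_multiplicity (\<lambda>x. k * I x) (interior J) = 1 \<longleftrightarrow> C * \<rho> < 0"
proof (cases "C * \<rho> < 0")
  case True
  then show ?thesis
    using count_eq_1_unstable count_eq_1_stable k by (auto simp: mult_less_0_iff)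
next
  case False
  have "zeros_counting_multiplicity (\<lambda>x. k * I x) (interior J) \<noteq> 1"
  \<comment> \<open>Here \<open>I\<close> vanishes identically on an infinite set, so the count is
    infinite and differs from 1.\<close>
  proof (cases "\<rho> = 0 \<and> C = 0")
    case zero: True
    have R: "R x (- x)" if "x \<ge> 0" for x
      using that R_exists_right[of x] R_asymmetric(3)[of x] zero by auto
    have L: "L u > 0" for u unfolding L_def using zero \<Delta> by simp
    have "J = {0..}"
    proof (intro set_eqI iffI)
      show "x \<in> J" if "x \<in> {0..}" for x
        using R[of x] that L unfolding J_iff by auto
    qed (auto simp: J_iff R_def)
    then have "interior J = {0<..}" by simp
    moreover have "I x = 0" if "x > 0" for x
      using I_eq[OF R L L] Q_reflect(3)[OF that L L] zero that by simp
    ultimately have "{x \<in> interior J. k * I x = 0} = {0<..}" by auto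
    then show ?thesis
      by (simp add: zeros_counting_multiplicity_def infinite_Ioi)
  next
    case nz: False
    \<comment> \<open>For \<open>\<rho> = 0\<close> the point 0 belongs to \<open>J\<close> and is a
      zero of \<open>I\<close>; passing to the interior removes it.\<close>
    have "J \<subseteq> {0..}" by (auto simp: J_iff R_def)
    then have "interior J \<subseteq> {0<..}" using interior_mono[of J "{0..}"] by simp
    then have "x \<in> J \<and> x > 0" if "x \<in> interior J" for x
      using that interior_subset by auto
    moreover have "\<rho> \<ge> 0 \<and> C \<ge> 0 \<or> \<rho> \<le> 0 \<and> C \<le> 0"
      using False by (auto simp: mult_less_0_iff)
    ultimately have none: "{x \<in> interior J. k * I x = 0} = {}"
      using I_nonzero nz k by auto
    show ?thesis unfolding zeros_counting_multiplicity_def none by simp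
  qed
  then show ?thesis using False by simp
qed

end

section \<open>Transfer to the vector fields\<close>

text \<open>Both statements are instances: \<open>b\<close> and \<open>A\<close> belong to either
  field, and \<open>H\<close> is the upper or lower half-plane according to the sign of
  \<open>A$2$1\<close>. For the lower field, b > 0 is the case \<open>VV1\<close>.\<close>

lemma slow_divergence_zeros_eq_1_iff:
  fixes A :: "real^2^2" and F :: "real \<times> real \<Rightarrow> real \<times> real"
  assumes F: "\<forall>x y. F (x, y) = (b + A$1$1 * x + A$1$2 * y, A$2$1 * x + A$2$2 * y)"
    and b: "b > 0" and A21: "A$2$1 \<noteq> 0"
    and focus: "det A > 0" "4 * det A - (trace A)\<^sup>2 > 0"
    and H: "H = {p. 0 < A$2$1 * snd p}"
    and \<Delta>: "Delta bp Ap bm Am > 0" and sl: "Ap$2$1 - Am$2$1 > 0"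
    and \<phi>: "\<And>s. deriv \<phi> s > 0"
  shows "zeros_counting_multiplicity
      (slow_divergence_integral \<phi> Ap Am (sliding_field bp Ap bm Am) (half_map F H))
      (interior (maximal_domain (sliding_field bp Ap bm Am) F H)) = 1
    \<longleftrightarrow> C_const Ap Am * trace A < 0"
proof -
  define \<sigma> where "\<sigma> = trace A / 2"
  \<comment> \<open>The eigenvalues of \<open>A\<close> are \<open>\<sigma>\<close> plus or minus i
    times \<open>\<omega>\<close>; the radicand is a quarter of
    \<open>4 * det A - (trace A)\<^sup>2\<close>.\<close>
  define \<omega> where "\<omega> = sqrt (det A - \<sigma>\<^sup>2)"
  define s where "s = b / det A"
  define \<rho> where "\<rho> = \<sigma> / \<omega>"
  define m where "m = \<omega> * s"
  have "det A - \<sigma>\<^sup>2 > 0" using focus by (simp add: \<sigma>_def power_divide)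
  then have \<omega>: "\<omega> > 0" "\<sigma>\<^sup>2 + \<omega>\<^sup>2 = det A" by (simp_all add: \<omega>_def)
  have s: "s > 0" "b = s * (\<sigma>\<^sup>2 + \<omega>\<^sup>2)" using b focus \<omega> by (simp_all add: s_def)
  have tr: "A$1$1 + A$2$2 = 2 * \<sigma>" by (simp add: \<sigma>_def trace_def UNIV_2)
  have dt: "A$1$1 * A$2$2 - A$1$2 * A$2$1 = \<sigma>\<^sup>2 + \<omega>\<^sup>2"
    using \<omega>(2) by (simp add: det_2)
  interpret slow_divergence \<rho> m "Delta bp Ap bm Am" "C_const Ap Am"
    using \<omega> s \<Delta> by unfold_locales (simp_all add: m_def)
  have R: "half_return F H = R"
    using half_return_iff[of F b "A$1$1" "A$1$2" "A$2$1" "A$2$2" \<sigma> \<omega> s, OF _ tr dt s(2) s(1) \<omega>(1) A21] F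
    unfolding H fun_eq_iff R_def unfolding \<rho>_def m_def by blast
  have P: "half_map F H = P"
    unfolding half_map_def P_def fun_eq_iff R by simp
  have Xsl: "sliding_field bp Ap bm Am u = L u / (Ap$2$1 - Am$2$1)" for u
    by (simp add: sliding_field_def L_def)
  have J: "maximal_domain (sliding_field bp Ap bm Am) F H = J"
    unfolding maximal_domain_def half_map_domain_def J_def R P Xsl using sl by auto
  \<comment> \<open>The factor \<open>Ap$2$1 - Am$2$1\<close> occurs twice: once from the prefactor
    of the integral, once from the denominator of the sliding field.\<close>
  define k where "k = (Ap$2$1 - Am$2$1) *
    deriv \<phi> (inv \<phi> (- Am$2$1 / (Ap$2$1 - Am$2$1))) * (Ap$2$1 - Am$2$1)"
  have "k > 0" unfolding k_def by (intro mult_pos_pos \<phi> sl)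
  have "(\<lambda>u. u / sliding_field bp Ap bm Am u) = (\<lambda>u. (Ap$2$1 - Am$2$1) * (u / L u))"
    unfolding Xsl by (simp add: mult.commute)
  then have I: "slow_divergence_integral \<phi> Ap Am (sliding_field bp Ap bm Am) (half_map F H) =
      (\<lambda>x. k * I x)"
    unfolding slow_divergence_integral_def I_def P k_def fun_eq_iff
    by (simp only: integral_mult_right) (simp only: mult.assoc simp_thms)
  have "C_const Ap Am * \<rho> = C_const Ap Am * trace A / (2 * \<omega>)"
    by (simp add: \<rho>_def \<sigma>_def)
  then have "C_const Ap Am * \<rho> < 0 \<longleftrightarrow> C_const Ap Am * trace A < 0"
    using \<omega> by (simp add: divide_less_0_iff)
  then show ?thesis
    unfolding I J using count_eq_1_iff[OF \<open>k > 0\<close>] by simp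
qed

theorem theorem4:
  fixes Zp Zm :: "real \<Rightarrow> real \<times> real \<Rightarrow> real \<times> real"
    and bp bm :: real
    and Ap Am :: "real^2^2"
    and \<phi> :: "real \<Rightarrow> real"
  assumes "smooth_affine_family Zp" and "smooth_affine_family Zm"
    and "\<forall>x y. Zp 0 (x, y) = (bp + Ap$1$1 * x + Ap$1$2 * y, Ap$2$1 * x + Ap$2$2 * y)"
    and "\<forall>x y. Zm 0 (x, y) = (bm + Am$1$1 * x + Am$1$2 * y, Am$2$1 * x + Am$2$2 * y)"
    and "bp > 0" and "Ap$2$1 > 0" and "Am$2$1 < 0"
    and "VV1 (Zp 0) (Zm 0) \<or> VI3 (Zp 0) (Zm 0)"
    and "Ylam_origin Zm * Yx_origin (Zp 0) \<noteq> Ylam_origin Zp * Yx_origin (Zm 0)"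
    and "regularization_function \<phi>"
  shows "(det Ap > 0 \<and> 4 * det Ap - (trace Ap)\<^sup>2 > 0 \<longrightarrow>
           (zeros_counting_multiplicity
              (slow_divergence_integral \<phi> Ap Am (sliding_field bp Ap bm Am)
                 (half_map (Zp 0) upper))
              (interior (maximal_domain (sliding_field bp Ap bm Am) (Zp 0) upper)) = 1
            \<longleftrightarrow> C_const Ap Am * trace Ap < 0)) \<and>
         (det Am > 0 \<and> 4 * det Am - (trace Am)\<^sup>2 > 0 \<and> VV1 (Zp 0) (Zm 0) \<longrightarrow>
           (zeros_counting_multiplicity
              (slow_divergence_integral \<phi> Ap Am (sliding_field bp Ap bm Am)
                 (half_map (Zm 0) lower))
              (interior (maximal_domain (sliding_field bp Ap bm Am) (Zm 0) lower)) = 1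
            \<longleftrightarrow> C_const Ap Am * trace Am < 0))"
proof -
  have sl: "Ap$2$1 - Am$2$1 > 0" using assms by simp
  have "bm > 0 \<Longrightarrow> Delta bp Ap bm Am > 0"
    using mult_pos_pos[of "Ap$2$1" bm] mult_neg_pos[of "Am$2$1" bp] assms(5-7)
    unfolding Delta_def by linarith
  then have \<Delta>: "Delta bp Ap bm Am > 0"
    using assms(8) VV1_VI3_affine[OF assms(3-7)] by blast
  have \<phi>: "deriv \<phi> s > 0" for s
    using assms(10) by (simp add: regularization_function_def)
  have up: "upper = {p. 0 < Ap$2$1 * snd p}" and low: "lower = {p. 0 < Am$2$1 * snd p}"
    using assms(6,7) by (auto simp: zero_less_mult_iff)
  show ?thesis
    using slow_divergence_zeros_eq_1_iff[OF assms(3) _ _ _ _ up \<Delta> sl \<phi>]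
      slow_divergence_zeros_eq_1_iff[OF assms(4) _ _ _ _ low \<Delta> sl \<phi>]
      VV1_VI3_affine(1)[OF assms(3-7)] assms(5-7)
    by auto
qed

end
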